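(* Let $(K,\mathcal{L})$ be a $C$-minimal valued field and let $f\colon X\subseteq K\to K^\times$ be a definable function defined at a neighborhood of infinity. Then $f$ factorizes at infinity over $\Gamma$ through a definable function $h$; that is, there are a definable function $h\colon \Gamma_K\to\Gamma_K$ and $\gamma_0\in\Gamma_K$ such that $v(f(x))=h(v(x))$ for all $x\in X\setminus B(0,\gamma_0)$.
   Context: Valued fields $(K,v)$ are non-trivially valued; $\Gamma_K$ is the value group. Closed balls are $B(a,\gamma)=\{x\in K: v(x-a)\geq\gamma\}$ for $a \in K$, $\gamma\in\Gamma_K\cup\{+\infty\}$; open balls are $B^\circ(a,\gamma)=\{x\in K: v(x-a)>\gamma\}$ for $a\in K$, $\gamma\in\Gamma_K\cup\{-\infty\}$ (so points are closed balls and $K$ is an open ball). A ball is a closed or an open ball. $\mathcal{L}_{div}=(+,-,\cdot,0,1,\mathrm{div})$ is the language of valued fields, with $\mathrm{div}(x,y)$ interpreted as $v(x)\leq v(y)$. Let $K$ be an algebraically closed valued field and $(K,\mathcal{L})$ an expansion of $(K,\mathcal{L}_{div})$ ($\mathcal{L}\supseteq\mathcal{L}_{div}$). $(K,\mathcal{L})$ is $C$-minimal (a "$C$-minimal valued field") if for every structure $(K',\mathcal{L})$ elementarily equivalent to it, every $\mathcal{L}$-definable subset of $K'$ is a boolean combination of balls. "Definable" means $\mathcal{L}$-definable with parameters; for subsets of (products involving) $\Gamma_K$ it means interpretable. A neighborhood of infinity is a set of the form $K\setminus B(0,\gamma)$ with $\gamma\in\Gamma_K$; $f\colon X\subseteq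 K\to K$ is defined at a neighborhood of infinity if $X$ contains such a set. *)

theory Defs
  imports
    "HOL-Library.Extended"
    "HOL-Computational_Algebra.Polynomial"
begin

section \<open>First-order logic\<close>

text \<open>A language is given by its sets of (symbol, arity) pairs.\<close>

record ('f, 'r) language =
  fsyms :: "('f \<times> nat) set"
  rsyms :: "('r \<times> nat) set"

datatype 'f trm = Var nat | App 'f "'f trm list"

datatype ('f, 'r) fm =
    Eq "'f trm" "'f trm"
  | Atom 'r "'f trm list"
  | Neg "('f, 'r) fm"
  | Conj "('f, 'r) fm" "('f, 'r) fm"
  | Ex nat "('f, 'r) fm"

fun wf_trm :: "('f, 'r) language \<Rightarrow> 'f trm \<Rightarrow> bool" where
  "wf_trm L (Var i) \<longleftrightarrow> True"
| "wf_trm L (App f ts) \<longleftrightarrow> (f, length ts) \<in> fsyms L \<and> (\<forall>t\<in>set ts. wf_trm L t)"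

fun wf_fm :: "('f, 'r) language \<Rightarrow> ('f, 'r) fm \<Rightarrow> bool" where
  "wf_fm L (Eq s t) \<longleftrightarrow> wf_trm L s \<and> wf_trm L t"
| "wf_fm L (Atom r ts) \<longleftrightarrow> (r, length ts) \<in> rsyms L \<and> (\<forall>t\<in>set ts. wf_trm L t)"
| "wf_fm L (Neg \<phi>) \<longleftrightarrow> wf_fm L \<phi>"
| "wf_fm L (Conj \<phi> \<psi>) \<longleftrightarrow> wf_fm L \<phi> \<and> wf_fm L \<psi>"
| "wf_fm L (Ex i \<phi>) \<longleftrightarrow> wf_fm L \<phi>"

fun fv_trm :: "'f trm \<Rightarrow> nat set" where
  "fv_trm (Var i) = {i}"
| "fv_trm (App f ts) = (\<Union>t\<in>set ts. fv_trm t)"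

fun fv_fm :: "('f, 'r) fm \<Rightarrow> nat set" where
  "fv_fm (Eq s t) = fv_trm s \<union> fv_trm t"
| "fv_fm (Atom r ts) = (\<Union>t\<in>set ts. fv_trm t)"
| "fv_fm (Neg \<phi>) = fv_fm \<phi>"
| "fv_fm (Conj \<phi> \<psi>) = fv_fm \<phi> \<union> fv_fm \<psi>"
| "fv_fm (Ex i \<phi>) = fv_fm \<phi> - {i}"

definition sentence :: "('f, 'r) language \<Rightarrow> ('f, 'r) fm \<Rightarrow> bool" where
  "sentence L \<phi> \<longleftrightarrow> wf_fm L \<phi> \<and> fv_fm \<phi> = {}"

record ('f, 'r, 'a) fo_structure =
  univ :: "'a set"
  fint :: "'f \<Rightarrow> 'a list \<Rightarrow> 'a"
  rint :: "'r \<Rightarrow> 'a list \<Rightarrow> bool"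

definition is_structure :: "('f, 'r) language \<Rightarrow> ('f, 'r, 'a) fo_structure \<Rightarrow> bool" where
  "is_structure L M \<longleftrightarrow> univ M \<noteq> {} \<and>
     (\<forall>(f, n)\<in>fsyms L. \<forall>xs. length xs = n \<and> set xs \<subseteq> univ M \<longrightarrow> fint M f xs \<in> univ M)"

fun eval_trm :: "('f, 'r, 'a) fo_structure \<Rightarrow> (nat \<Rightarrow> 'a) \<Rightarrow> 'f trm \<Rightarrow> 'a" where
  "eval_trm M \<sigma> (Var i) = \<sigma> i"
| "eval_trm M \<sigma> (App f ts) = fint M f (map (eval_trm M \<sigma>) ts)"

fun sat :: "('f, 'r, 'a) fo_structure \<Rightarrow> (nat \<Rightarrow> 'a) \<Rightarrow> ('f, 'r) fm \<Rightarrow> bool" where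
  "sat M \<sigma> (Eq s t) \<longleftrightarrow> eval_trm M \<sigma> s = eval_trm M \<sigma> t"
| "sat M \<sigma> (Atom r ts) \<longleftrightarrow> rint M r (map (eval_trm M \<sigma>) ts)"
| "sat M \<sigma> (Neg \<phi>) \<longleftrightarrow> \<not> sat M \<sigma> \<phi>"
| "sat M \<sigma> (Conj \<phi> \<psi>) \<longleftrightarrow> sat M \<sigma> \<phi> \<and> sat M \<sigma> \<psi>"
| "sat M \<sigma> (Ex i \<phi>) \<longleftrightarrow> (\<exists>a\<in>univ M. sat M (\<sigma>(i := a)) \<phi>)"

definition models :: "('f, 'r, 'a) fo_structure \<Rightarrow> ('f, 'r) fm \<Rightarrow> bool" where
  "models M \<phi> \<longleftrightarrow> (\<forall>\<sigma>. range \<sigma> \<subseteq> univ M \<longrightarrow> sat M \<sigma> \<phi>)"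

definition elem_equiv ::
  "('f, 'r) language \<Rightarrow> ('f, 'r, 'a) fo_structure \<Rightarrow> ('f, 'r, 'b) fo_structure \<Rightarrow> bool" where
  "elem_equiv L M N \<longleftrightarrow> (\<forall>\<phi>. sentence L \<phi> \<longrightarrow> (models M \<phi> \<longleftrightarrow> models N \<phi>))"

text \<open>
  Definability with parameters of a set of \<open>n\<close>-tuples: the variables \<open>0, \<dots>, n - 1\<close> are
  those of the tuple, and \<open>\<sigma>\<close> assigns parameters to the other variables.
\<close>

definition definable ::
  "('f, 'r) language \<Rightarrow> ('f, 'r, 'a) fo_structure \<Rightarrow> nat \<Rightarrow> 'a list set \<Rightarrow> bool" where
  "definable L M n S \<longleftrightarrow> (\<exists>\<phi> \<sigma>. wf_fm L \<phi> \<and> range \<sigma> \<subseteq> univ M \<and>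
     S = {xs. length xs = n \<and> set xs \<subseteq> univ M \<and>
              sat M (\<lambda>i. if i < n then xs ! i else \<sigma> i) \<phi>})"

definition definable_set ::
  "('f, 'r) language \<Rightarrow> ('f, 'r, 'a) fo_structure \<Rightarrow> 'a set \<Rightarrow> bool" where
  "definable_set L M S \<longleftrightarrow> definable L M 1 {[x] | x. x \<in> S}"

text \<open>Definability of the partial function with domain \<open>X\<close> that is given there by \<open>f\<close>.\<close>

definition definable_fun ::
  "('f, 'r) language \<Rightarrow> ('f, 'r, 'a) fo_structure \<Rightarrow> 'a set \<Rightarrow> ('a \<Rightarrow> 'a) \<Rightarrow> bool" where
  "definable_fun L M X f \<longleftrightarrow> definable L M 2 {[x, f x] | x. x \<in> X}"

inductive_set bool_combs :: "'a set \<Rightarrow> 'a set set \<Rightarrow> 'a set set" for U \<B> where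
  basic: "B \<in> \<B> \<Longrightarrow> B \<in> bool_combs U \<B>"
| compl: "A \<in> bool_combs U \<B> \<Longrightarrow> U - A \<in> bool_combs U \<B>"
| union: "A \<in> bool_combs U \<B> \<Longrightarrow> B \<in> bool_combs U \<B> \<Longrightarrow> A \<union> B \<in> bool_combs U \<B>"


section \<open>Valued fields\<close>

text \<open>
  Valuations take values in \<open>'g extended\<close>, with \<open>v 0 = Pinf\<close>; the value group may be a proper
  subgroup of \<open>'g\<close>. \<open>Minf\<close> is never a value, but it is the radius of the open ball \<open>K\<close>.
\<close>

definition valuation :: "('a::field \<Rightarrow> 'g::linordered_ab_group_add extended) \<Rightarrow> bool" where
  "valuation v \<longleftrightarrow>
     v 0 = Pinf \<and> (\<forall>x. x \<noteq> 0 \<longrightarrow> (\<exists>\<gamma>. v x = Fin \<gamma>)) \<and>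
     (\<forall>x y. v (x * y) = v x + v y) \<and> (\<forall>x y. min (v x) (v y) \<le> v (x + y))"

definition nontrivial_valuation ::
  "('a::field \<Rightarrow> 'g::linordered_ab_group_add extended) \<Rightarrow> bool" where
  "nontrivial_valuation v \<longleftrightarrow> valuation v \<and> (\<exists>x. x \<noteq> 0 \<and> v x \<noteq> 0)"

definition value_group :: "('a::field \<Rightarrow> 'g::linordered_ab_group_add extended) \<Rightarrow> 'g set" where
  "value_group v = {\<gamma>. \<exists>x. v x = Fin \<gamma>}"

definition closed_ball ::
  "('a::field \<Rightarrow> 'g::linordered_ab_group_add extended) \<Rightarrow> 'a \<Rightarrow> 'g extended \<Rightarrow> 'a set" where
  "closed_ball v a \<gamma> = {x. \<gamma> \<le> v (x - a)}"

definition open_ball ::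
  "('a::field \<Rightarrow> 'g::linordered_ab_group_add extended) \<Rightarrow> 'a \<Rightarrow> 'g extended \<Rightarrow> 'a set" where
  "open_ball v a \<gamma> = {x. \<gamma> < v (x - a)}"

definition balls :: "('a::field \<Rightarrow> 'g::linordered_ab_group_add extended) \<Rightarrow> 'a set set" where
  "balls v = {closed_ball v a \<gamma> | a \<gamma>. \<gamma> \<in> Fin ` value_group v \<union> {Pinf}} \<union>
             {open_ball v a \<gamma> | a \<gamma>. \<gamma> \<in> Fin ` value_group v \<union> {Minf}}"

definition defined_near_infinity ::
  "('a::field \<Rightarrow> 'g::linordered_ab_group_add extended) \<Rightarrow> 'a set \<Rightarrow> bool" where
  "defined_near_infinity v X \<longleftrightarrow> (\<exists>\<gamma>\<in>value_group v. UNIV - closed_ball v 0 (Fin \<gamma>) \<subseteq> X)"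


section \<open>Expansions of valued fields and C-minimality\<close>

datatype 'f vf_fsym = Add | Sub | Mul | Zero | One | ExtraF 'f

datatype 'r vf_rsym = Div | ExtraR 'r

definition L_div :: "('f vf_fsym, 'r vf_rsym) language" where
  "L_div = \<lparr>fsyms = {(Add, 2), (Sub, 2), (Mul, 2), (Zero, 0), (One, 0)}, rsyms = {(Div, 2)}\<rparr>"

definition sublanguage :: "('f, 'r) language \<Rightarrow> ('f, 'r) language \<Rightarrow> bool" where
  "sublanguage L L' \<longleftrightarrow> fsyms L \<subseteq> fsyms L' \<and> rsyms L \<subseteq> rsyms L'"

definition expands_valued_field ::
  "('f vf_fsym, 'r vf_rsym, 'a::field) fo_structure \<Rightarrow>
   ('a \<Rightarrow> 'g::linordered_ab_group_add extended) \<Rightarrow> bool" where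
  "expands_valued_field M v \<longleftrightarrow>
     univ M = UNIV \<and>
     (\<forall>x y. fint M Add [x, y] = x + y) \<and>
     (\<forall>x y. fint M Sub [x, y] = x - y) \<and>
     (\<forall>x y. fint M Mul [x, y] = x * y) \<and>
     fint M Zero [] = 0 \<and>
     fint M One [] = 1 \<and>
     (\<forall>x y. rint M Div [x, y] \<longleftrightarrow> v x \<le> v y)"

text \<open>
  A structure elementarily equivalent to an expansion of a valued field comes without a chosen
  value group. The radii other than \<open>-\<infinity>\<close> are the \<open>v c\<close>, where \<open>c\<close> is an element of the field
  (nonzero for open balls), so that its balls can be read off from \<open>Div\<close>.
\<close>

definition div_balls :: "('f vf_fsym, 'r vf_rsym, 'a) fo_structure \<Rightarrow> 'a set set" where
  "div_balls N =
     {{x \<in> univ N. rint N Div [c, fint N Sub [x, a]]} | a c. a \<in> univ N \<and> c \<in> univ N} \<union>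
     {{x \<in> univ N. \<not> rint N Div [fint N Sub [x, a], c]} | a c.
        a \<in> univ N \<and> c \<in> univ N \<and> c \<noteq> fint N Zero []} \<union>
     {univ N}"

lemma div_balls_eq_balls:
  assumes v: "valuation v" and M: "expands_valued_field M v"
  shows "div_balls M = balls v"
proof -
  have v0: "v 0 = Pinf" and fin: "\<And>x. x \<noteq> 0 \<Longrightarrow> \<exists>\<gamma>. v x = Fin \<gamma>"
    using v by (auto simp: valuation_def)
  have rad': "Fin ` value_group v = {v c | c. c \<noteq> 0}"
  proof (intro set_eqI iffI)
    fix \<gamma> assume "\<gamma> \<in> Fin ` value_group v"
    then obtain \<delta> c where "\<gamma> = Fin \<delta>" "v c = Fin \<delta>" by (auto simp: value_group_def)
    then have "\<gamma> = v c" "c \<noteq> 0" using v0 by auto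
    then show "\<gamma> \<in> {v c | c. c \<noteq> 0}" by blast
  next
    fix \<gamma> assume "\<gamma> \<in> {v c | c. c \<noteq> 0}"
    then obtain c \<delta> where "\<gamma> = Fin \<delta>" "v c = Fin \<delta>" using fin by force
    then show "\<gamma> \<in> Fin ` value_group v" by (auto simp: value_group_def)
  qed
  have rad: "Fin ` value_group v \<union> {Pinf} = range v"
    unfolding rad' v0[symmetric] by blast
  have "Minf < v x" for x
    using v0 fin[of x] by (cases "x = 0") auto
  then have "open_ball v a Minf = UNIV" for a
    by (auto simp: open_ball_def)
  then have opens: "{open_ball v a \<gamma> | a \<gamma>. \<gamma> \<in> Fin ` value_group v \<union> {Minf}} =
      {open_ball v a (v c) | a c. c \<noteq> 0} \<union> {UNIV}"
    unfolding rad' by blast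
  have "{closed_ball v a \<gamma> | a \<gamma>. \<gamma> \<in> Fin ` value_group v \<union> {Pinf}} =
      {closed_ball v a (v c) | a c. True}"
    unfolding rad by blast
  with opens have "balls v = {closed_ball v a (v c) | a c. True} \<union>
      {open_ball v a (v c) | a c. c \<noteq> 0} \<union> {UNIV}"
    by (simp add: balls_def Un_assoc)
  then show ?thesis
    using M by (simp add: expands_valued_field_def div_balls_def
        closed_ball_def open_ball_def not_le)
qed

text \<open>
  HOL cannot quantify over the type that carries the elementarily equivalent structure \<open>N\<close>;
  \<open>N\<close> ranges over the structures on subsets of the type \<open>(nat \<Rightarrow> 'a) set\<close>. This is no
  restriction. Suppose that for some formula \<open>\<phi>\<close> and each \<open>n\<close> there are parameters in \<open>M\<close> for
  which \<open>\<phi>\<close> does not define a boolean combination of at most \<open>n\<close> balls. Then in a nonprincipal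
  ultrapower of \<open>M\<close> along \<open>nat\<close>, whose elements are sets of sequences in \<open>M\<close>, some set defined
  by \<open>\<phi>\<close> is not a boolean combination of balls. Otherwise, each \<open>\<phi>\<close> has a bound \<open>n\<close> that works
  for all parameters; this is expressed by a sentence, and hence holds in every structure
  elementarily equivalent to \<open>M\<close>, of whatever cardinality.
\<close>

definition C_minimal ::
  "('f vf_fsym, 'r vf_rsym) language \<Rightarrow> ('f vf_fsym, 'r vf_rsym, 'a) fo_structure \<Rightarrow> bool" where
  "C_minimal L M \<longleftrightarrow>
     (\<forall>N :: ('f vf_fsym, 'r vf_rsym, (nat \<Rightarrow> 'a) set) fo_structure.
        is_structure L N \<and> elem_equiv L M N \<longrightarrow>
        (\<forall>S. definable_set L N S \<longrightarrow> S \<in> bool_combs (univ N) (div_balls N)))"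

definition C_minimal_valued_field ::
  "('f vf_fsym, 'r vf_rsym) language \<Rightarrow>
   ('f vf_fsym, 'r vf_rsym, 'a::alg_closed_field) fo_structure \<Rightarrow>
   ('a \<Rightarrow> 'g::linordered_ab_group_add extended) \<Rightarrow> bool" where
  "C_minimal_valued_field L M v \<longleftrightarrow>
     nontrivial_valuation v \<and> sublanguage L_div L \<and> is_structure L M \<and>
     expands_valued_field M v \<and> C_minimal L M"

text \<open>
  A set of \<open>n\<close>-tuples from the value group is interpretable if its preimage under \<open>v\<close>
  is definable in the field.
\<close>

definition interpretable ::
  "('f, 'r) language \<Rightarrow> ('f, 'r, 'a::field) fo_structure \<Rightarrow>
   ('a \<Rightarrow> 'g::linordered_ab_group_add extended) \<Rightarrow> nat \<Rightarrow> 'g list set \<Rightarrow> bool" where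
  "interpretable L M v n S \<longleftrightarrow>
     S \<subseteq> {\<gamma>s. length \<gamma>s = n \<and> set \<gamma>s \<subseteq> value_group v} \<and>
     definable L M n {xs. \<exists>\<gamma>s\<in>S. map v xs = map Fin \<gamma>s}"

definition definable_value_fun ::
  "('f, 'r) language \<Rightarrow> ('f, 'r, 'a::field) fo_structure \<Rightarrow>
   ('a \<Rightarrow> 'g::linordered_ab_group_add extended) \<Rightarrow> ('g \<Rightarrow> 'g) \<Rightarrow> bool" where
  "definable_value_fun L M v h \<longleftrightarrow>
     h ` value_group v \<subseteq> value_group v \<and>
     interpretable L M v 2 {[\<gamma>, h \<gamma>] | \<gamma>. \<gamma> \<in> value_group v}"

end

theory Submission
  imports Defs
begin

text \<open>
  A boolean combination of balls contains a neighborhood of infinity or is disjoint from one, and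
  it contains almost all or almost no points of an infinite set of points at the same distance
  from each other. Applied in an ultrapower, the latter fact gives a bound \<open>N\<close> for each formula:
  for all parameters, a finite set of equidistant points does not contain \<open>N\<close> points that satisfy
  the formula and also \<open>N\<close> points that do not.

  Call \<open>x\<close> dominating if \<open>v (f z) < v (f x)\<close> for all \<open>z\<close> in some residue class
  \<open>{z. v (z - y) > v x}\<close> with \<open>v y = v x\<close>. Near infinity, all points or none are dominating. If all
  are, then one can descend through pairwise distinct classes with decreasing values of \<open>f\<close>, which
  contradicts the bound for \<open>v (f t) < v (f c)\<close>. So none are, and likewise for \<open>>\<close>. If now
  \<open>v x = v x'\<close> and \<open>v (f x) < v (f x')\<close>, then each residue class contains values that are at most
  \<open>v (f x)\<close> and values that are at least \<open>v (f x')\<close>, which contradicts the bound again.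
\<close>

section \<open>Ultrapowers\<close>

text \<open>Zorn's lemma gives a minimal proper filter below \<open>sequentially\<close>, where
  smaller filters are finer; minimality makes it decide every predicate.\<close>

lemma nonprincipal_ultrafilter_exists:
  "\<exists>F :: nat filter. F \<le> sequentially \<and>
     (\<forall>P. eventually (\<lambda>n. \<not> P n) F \<longleftrightarrow> \<not> eventually P F)"
proof -
  let ?A = "{F :: nat filter. F \<noteq> bot \<and> F \<le> sequentially}"
  have "\<exists>m\<in>?A. \<forall>a\<in>?A. a \<le> m \<longrightarrow> a = m"
  proof (rule predicate_Zorn)
    show "partial_order_on ?A (relation_of (\<lambda>a b. b \<le> a) ?A)"
      by (rule partial_order_on_relation_ofI) auto
  next
    fix C assume C: "C \<in> Chains (relation_of (\<lambda>a b. b \<le> a) ?A)"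
    then have CA: "C \<subseteq> ?A" and ch: "\<And>a b. a \<in> C \<Longrightarrow> b \<in> C \<Longrightarrow> a \<le> b \<or> b \<le> a"
      by (auto simp: Chains_def relation_of_def)
    show "\<exists>u\<in>?A. \<forall>a\<in>C. u \<le> a"
    proof (cases "C = {}")
      case True
      then show ?thesis by (auto intro!: exI[of _ sequentially])
    next
      case False
      \<comment> \<open>A chain is directed, so an event of the infimum is already an event of one
        member, and properness passes to the infimum.\<close>
      have "eventually P (Inf C) \<longleftrightarrow> (\<exists>b\<in>C. eventually P b)" for P
      proof (rule eventually_Inf_base[OF False])
        show "\<exists>x\<in>C. x \<le> inf a b" if "a \<in> C" "b \<in> C" for a b
          using ch[OF that] that by (auto simp: le_inf_iff)
      qed
      then have "Inf C \<noteq> bot"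
        using CA by (auto simp: trivial_limit_def)
      moreover have "Inf C \<le> sequentially"
      proof -
        from False obtain c where "c \<in> C" by blast
        then show ?thesis using CA by (auto intro: Inf_lower2)
      qed
      ultimately show ?thesis by (auto intro: Inf_lower)
    qed
  qed
  then obtain F where F: "F \<noteq> bot" "F \<le> sequentially"
    and "\<forall>G\<in>?A. G \<le> F \<longrightarrow> G = F"
    by blast
  then have min: "G = F" if "G \<noteq> bot" "G \<le> F" for G
    using that order_trans[of G F sequentially] by blast
  have "eventually P F" if "\<not> eventually (\<lambda>n. \<not> P n) F" for P
  proof -
    \<comment> \<open>Adding the set of all \<open>n\<close> with \<open>P n\<close> to
      \<open>F\<close> keeps the filter proper, so by minimality it adds nothing.\<close>
    have "inf F (principal {n. P n}) \<noteq> bot"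
      using that by (auto simp: trivial_limit_def eventually_inf_principal)
    with min have "inf F (principal {n. P n}) = F" by simp
    then have "eventually P F \<longleftrightarrow> eventually P (inf F (principal {n. P n}))" by simp
    then show ?thesis by (simp add: eventually_inf_principal)
  qed
  moreover have "\<not> eventually P F" if "eventually (\<lambda>n. \<not> P n) F" for P
    using F(1) eventually_conj[OF that, of P] by (auto simp: trivial_limit_def)
  ultimately show ?thesis
    using F(2) by blast
qed

section \<open>The ultrapower of a structure and the theorem of Los\<close>

locale ultrapower =
  fixes F :: "nat filter" and M :: "('f, 'r, 'a) fo_structure"
  assumes nonprincipal: "F \<le> sequentially"
    and ultra: "\<And>P. eventually (\<lambda>n. \<not> P n) F \<longleftrightarrow> \<not> eventually P F"
    and univ_M: "univ M = UNIV"
begin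

text \<open>Classes are literal sets of sequences, so that the ultrapower lives on the carrier type
  over which \<open>C_minimal\<close> quantifies.\<close>

definition cls :: "(nat \<Rightarrow> 'a) \<Rightarrow> (nat \<Rightarrow> 'a) set" where
  "cls g = {h. eventually (\<lambda>n. h n = g n) F}"

definition rep :: "(nat \<Rightarrow> 'a) set \<Rightarrow> nat \<Rightarrow> 'a" where
  "rep X = (SOME g. g \<in> X)"

definition upow :: "('f, 'r, (nat \<Rightarrow> 'a) set) fo_structure" where
  "upow = \<lparr>univ = range cls,
     fint = (\<lambda>f xs. cls (\<lambda>n. fint M f (map (\<lambda>X. rep X n) xs))),
     rint = (\<lambda>r xs. eventually (\<lambda>n. rint M r (map (\<lambda>X. rep X n) xs)) F)\<rparr>"

lemma univ_upow: "univ upow = range cls"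
  by (simp add: upow_def)

lemma F_nontrivial: "\<not> eventually (\<lambda>n. False) F"
  using ultra[of "\<lambda>n. False"] by simp

lemma eventually_F_gt: "eventually (\<lambda>n. n > k) F"
  using nonprincipal eventually_gt_at_top filter_leD by blast

lemma cls_eq_iff: "cls g = cls h \<longleftrightarrow> eventually (\<lambda>n. g n = h n) F"
proof
  assume "cls g = cls h"
  moreover have "g \<in> cls g" by (simp add: cls_def)
  ultimately show "eventually (\<lambda>n. g n = h n) F" by (simp add: cls_def)
next
  assume e: "eventually (\<lambda>n. g n = h n) F"
  have "eventually (\<lambda>n. k n = g n) F \<longleftrightarrow> eventually (\<lambda>n. k n = h n) F" for k
    by (rule eventually_cong[OF e]) simp
  then show "cls g = cls h" by (auto simp: cls_def)
qed

lemma rep_cls: "eventually (\<lambda>n. rep (cls g) n = g n) F"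
proof -
  have "rep (cls g) \<in> cls g"
    unfolding rep_def by (rule someI[of _ g]) (simp add: cls_def)
  then show ?thesis by (simp add: cls_def)
qed

lemma map_rep_cls:
  "eventually (\<lambda>n. map (\<lambda>X. rep X n) (map (\<lambda>t. cls (e t)) ts) = map (\<lambda>t. e t n) ts) F"
proof (induction ts)
  case (Cons t ts)
  then show ?case
    using rep_cls[of "e t"] by eventually_elim simp
qed simp

lemma fint_upow: "fint upow f (map (\<lambda>t. cls (e t)) ts) = cls (\<lambda>n. fint M f (map (\<lambda>t. e t n) ts))"
  unfolding upow_def
  by (simp add: cls_eq_iff del: map_map, rule eventually_mono[OF map_rep_cls[of e ts]])
    (simp del: map_map)

lemma rint_upow:
  "rint upow r (map (\<lambda>t. cls (e t)) ts) \<longleftrightarrow> eventually (\<lambda>n. rint M r (map (\<lambda>t. e t n) ts)) F"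
  unfolding upow_def
  by (simp del: map_map, rule eventually_cong[OF map_rep_cls[of e ts]]) (simp del: map_map)

lemma eval_trm_upow:
  "eval_trm upow (\<lambda>i. cls (s i)) t = cls (\<lambda>n. eval_trm M (\<lambda>i. s i n) t)"
proof (induction t)
  case (App f ts)
  then have "map (eval_trm upow (\<lambda>i. cls (s i))) ts =
      map (\<lambda>t. cls (\<lambda>n. eval_trm M (\<lambda>i. s i n) t)) ts"
    by simp
  then show ?case by (simp add: fint_upow del: map_eq_conv)
qed simp

lemma cls_fun_upd: "(\<lambda>j. cls (s j))(i := cls g) = (\<lambda>j. cls ((s(i := g)) j))"
  by (simp add: fun_eq_iff)

text \<open>Induction on formulas: negation needs the ultrafilter property, and the quantifier needs
  a choice of witnesses.\<close>

theorem los: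
  "sat upow (\<lambda>i. cls (s i)) \<phi> \<longleftrightarrow> eventually (\<lambda>n. sat M (\<lambda>i. s i n) \<phi>) F"
proof (induction \<phi> arbitrary: s)
  case (Eq t u)
  then show ?case by (simp add: eval_trm_upow cls_eq_iff)
next
  case (Atom r ts)
  have "map (eval_trm upow (\<lambda>i. cls (s i))) ts =
      map (\<lambda>t. cls (\<lambda>n. eval_trm M (\<lambda>i. s i n) t)) ts"
    by (simp add: eval_trm_upow)
  then show ?case by (simp add: rint_upow del: map_eq_conv)
next
  case (Neg \<phi>)
  then show ?case by (simp add: ultra)
next
  case (Conj \<phi> \<psi>)
  then show ?case by (simp add: eventually_conj_iff)
next
  case (Ex i \<phi>)
  have upd: "(\<lambda>j. (s(i := g)) j n) = (\<lambda>j. s j n)(i := g n)" for g :: "nat \<Rightarrow> 'a" and n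
    by auto
  have "sat upow (\<lambda>j. cls (s j)) (Ex i \<phi>) \<longleftrightarrow>
      (\<exists>g. eventually (\<lambda>n. sat M ((\<lambda>j. s j n)(i := g n)) \<phi>) F)"
    by (simp add: univ_upow cls_fun_upd Ex.IH upd del: fun_upd_apply)
  also have "\<dots> \<longleftrightarrow> eventually (\<lambda>n. \<exists>a. sat M ((\<lambda>j. s j n)(i := a)) \<phi>) F"
  proof
    assume "\<exists>g. eventually (\<lambda>n. sat M ((\<lambda>j. s j n)(i := g n)) \<phi>) F"
    then show "eventually (\<lambda>n. \<exists>a. sat M ((\<lambda>j. s j n)(i := a)) \<phi>) F"
      by (auto elim: eventually_mono)
  next
    assume e: "eventually (\<lambda>n. \<exists>a. sat M ((\<lambda>j. s j n)(i := a)) \<phi>) F"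
    \<comment> \<open>The witness sequence is chosen index by index; its class witnesses the
      existential formula in the ultrapower.\<close>
    have "eventually (\<lambda>n. sat M ((\<lambda>j. s j n)(i := (SOME a. sat M ((\<lambda>j. s j n)(i := a)) \<phi>))) \<phi>) F"
      using e by eventually_elim (rule someI_ex)
    then show "\<exists>g. eventually (\<lambda>n. sat M ((\<lambda>j. s j n)(i := g n)) \<phi>) F"
      by (rule exI[of _ "\<lambda>n. SOME a. sat M ((\<lambda>j. s j n)(i := a)) \<phi>"])
  qed
  also have "\<dots> \<longleftrightarrow> eventually (\<lambda>n. sat M (\<lambda>j. s j n) (Ex i \<phi>)) F"
    by (simp add: univ_M)
  finally show ?case .
qed

lemma is_structure_upow: "is_structure L upow"
  by (auto simp: is_structure_def upow_def)

lemma range_in_upow: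
  assumes "range \<sigma> \<subseteq> univ upow"
  obtains s where "\<sigma> = (\<lambda>i. cls (s i))"
proof -
  have "\<forall>i. \<exists>g. \<sigma> i = cls g"
    using assms by (auto simp: univ_upow)
  then show ?thesis using that by (metis ext)
qed

lemma elem_equiv_upow: "elem_equiv L M upow"
proof -
  have "models upow \<phi>" if "models M \<phi>" for \<phi>
    unfolding models_def
    using that by (auto simp: models_def univ_M los elim!: range_in_upow)
  moreover have "models M \<phi>" if m: "models upow \<phi>" for \<phi>
    unfolding models_def
  proof (intro allI impI)
    fix \<sigma> :: "nat \<Rightarrow> 'a"
    \<comment> \<open>Constant sequences carry an assignment of \<open>M\<close> into the
      ultrapower, and truth at index \<open>n\<close> then does not depend on
      \<open>n\<close>.\<close>
    have "sat upow (\<lambda>i. cls (\<lambda>n. \<sigma> i)) \<phi>"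
      using m unfolding models_def univ_upow by (rule allE[of _ "\<lambda>i. cls (\<lambda>n. \<sigma> i)"]) auto
    then have "eventually (\<lambda>n. sat M \<sigma> \<phi>) F" by (simp only: los)
    then show "sat M \<sigma> \<phi>"
      using F_nontrivial by (cases "sat M \<sigma> \<phi>") simp_all
  qed
  ultimately show ?thesis by (auto simp: elem_equiv_def)
qed

end

section \<open>Definable sets in C-minimal valued fields\<close>

locale valued =
  fixes v :: "'a::field \<Rightarrow> 'g::linordered_ab_group_add extended"
  assumes valuation: "valuation v"
begin

lemma v_0: "v 0 = Pinf"
  and v_mult: "v (x * y) = v x + v y"
  and v_add: "min (v x) (v y) \<le> v (x + y)"
  and v_Fin: "x \<noteq> 0 \<Longrightarrow> \<exists>\<gamma>. v x = Fin \<gamma>"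
  using valuation by (auto simp: valuation_def)

lemma v_1: "v 1 = 0"
proof -
  obtain \<gamma> where \<gamma>: "v 1 = Fin \<gamma>" using v_Fin[of 1] by auto
  with v_mult[of 1 1] show ?thesis by (simp add: zero_extended_def)
qed

lemma v_minus: "v (- x) = v x"
proof -
  obtain \<gamma> where \<gamma>: "v (- 1) = Fin \<gamma>" using v_Fin[of "- 1"] by auto
  with v_mult[of "- 1" "- 1"] have "\<gamma> = 0" by (simp add: v_1 zero_extended_def)
  with \<gamma> v_mult[of "- 1" x] show ?thesis by (simp flip: zero_extended_def)
qed

lemma v_diff_commute: "v (x - y) = v (y - x)"
  using v_minus[of "x - y"] by simp

text \<open>The relation \<open>R\<close> allows closed and open balls to be treated at
  once.\<close>

lemma v_diff_trans:
  assumes R: "R = (\<le>) \<or> R = (<)" and xy: "R \<gamma> (v (x - y))" and yz: "R \<gamma> (v (y - z))"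
  shows "R \<gamma> (v (x - z))"
proof -
  have "min (v (x - y)) (v (y - z)) \<le> v (x - z)"
    using v_add[of "x - y" "y - z"] by simp
  then show ?thesis
    using R xy yz by (auto simp: min_def split: if_splits)
qed

lemma common_radius:
  assumes "d \<noteq> 0" "e \<noteq> 0"
  obtains m where "m \<noteq> 0" "v m \<le> v d" "v m \<le> v e"
  using assms by (cases "v d \<le> v e") auto

text \<open>The bound is a nonzero field element, which keeps the radius inside the value group; the
  type of values may be larger.\<close>

definition const_near_infinity :: "('a \<Rightarrow> bool) \<Rightarrow> bool" where
  "const_near_infinity P \<longleftrightarrow>
     (\<exists>e. e \<noteq> 0 \<and> ((\<forall>x. v x < v e \<longrightarrow> P x) \<or> (\<forall>x. v x < v e \<longrightarrow> \<not> P x)))"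

definition equidistant :: "'a set \<Rightarrow> bool" where
  "equidistant T \<longleftrightarrow> (\<exists>\<rho>. \<forall>x\<in>T. \<forall>y\<in>T. x \<noteq> y \<longrightarrow> v (x - y) = \<rho>)"

end

section \<open>Balls in the ultrapower of a valued field\<close>

locale valued_ultrapower = ultrapower F M + valued v
  for F :: "nat filter"
    and M :: "('f vf_fsym, 'r vf_rsym, 'a::field) fo_structure"
    and v :: "'a \<Rightarrow> 'g::linordered_ab_group_add extended" +
  assumes expands: "expands_valued_field M v"
begin

lemma Sub_upow: "fint upow Sub [cls x, cls y] = cls (\<lambda>n. x n - y n)"
  using fint_upow[of Sub "\<lambda>x. x" "[x, y]"] expands by (simp add: expands_valued_field_def)

lemma Div_upow: "rint upow Div [cls x, cls y] \<longleftrightarrow> eventually (\<lambda>n. v (x n) \<le> v (y n)) F"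
  using rint_upow[of Div "\<lambda>x. x" "[x, y]"] expands by (simp add: expands_valued_field_def)

text \<open>The interpretation of \<open>Div\<close> reads a ball as a sequence of balls of the
  field. For open balls, the negation moves inside \<open>eventually\<close> because
  \<open>F\<close> is an ultrafilter.\<close>

lemma div_balls_upow:
  assumes "B \<in> div_balls upow"
  shows "B = univ upow \<or> (\<exists>a c R. (R = (\<le>) \<or> R = (<)) \<and>
           (\<forall>x. cls x \<in> B \<longleftrightarrow> eventually (\<lambda>n. R (v (c n)) (v (x n - a n))) F))"
proof -
  consider a c where "B = {x \<in> univ upow. rint upow Div [cls c, fint upow Sub [x, cls a]]}"
    | a c where "B = {x \<in> univ upow. \<not> rint upow Div [fint upow Sub [x, cls a], cls c]}"
    | "B = univ upow"
    using assms unfolding div_balls_def univ_upow by blast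
  then show ?thesis
  proof cases
    case (1 a c)
    then have "\<forall>x. cls x \<in> B \<longleftrightarrow> eventually (\<lambda>n. (\<le>) (v (c n)) (v (x n - a n))) F"
      by (simp add: univ_upow Sub_upow Div_upow)
    then show ?thesis by blast
  next
    case (2 a c)
    then have "\<forall>x. cls x \<in> B \<longleftrightarrow> eventually (\<lambda>n. (<) (v (c n)) (v (x n - a n))) F"
      by (simp add: univ_upow Sub_upow Div_upow not_le flip: ultra)
    then show ?thesis by blast
  next
    case 3
    then show ?thesis by simp
  qed
qed

text \<open>Two points of the family in a ball bound its radius by their common distance, so the
  ball then holds the whole family. Otherwise it holds at most one of the points.\<close>

lemma div_ball_equidistant:
  assumes B: "B \<in> div_balls upow"
    and t: "\<And>i j. i \<noteq> j \<Longrightarrow> eventually (\<lambda>n. v (t i n - t j n) = \<rho> n) F"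
  shows "finite {i. cls (t i) \<in> B} \<or> finite {i. cls (t i) \<notin> B}"
proof (cases "B = univ upow")
  case True
  then show ?thesis by (simp add: univ_upow)
next
  case False
  then obtain a c R where R: "R = (\<le>) \<or> R = (<)"
    and mem: "\<And>x. cls x \<in> B \<longleftrightarrow> eventually (\<lambda>n. R (v (c n)) (v (x n - a n))) F"
    using div_balls_upow[OF B] by blast
  have all: "cls (t k) \<in> B" if ij: "i \<noteq> j" "cls (t i) \<in> B" "cls (t j) \<in> B" for i j k
  proof (cases "k = i")
    case False
    have i: "eventually (\<lambda>n. R (v (c n)) (v (t i n - a n))) F"
      and j: "eventually (\<lambda>n. R (v (c n)) (v (t j n - a n))) F"
      using ij by (simp_all add: mem)
    have "eventually (\<lambda>n. R (v (c n)) (v (t k n - a n))) F"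
      using i j t[OF ij(1)] t[OF False]
    proof eventually_elim
      case (elim n)
      from elim(2) have "R (v (c n)) (v (a n - t j n))" by (simp add: v_diff_commute)
      with elim(1) have "R (v (c n)) (v (t i n - t j n))" by (rule v_diff_trans[OF R])
      then have "R (v (c n)) (v (t k n - t i n))" using elim by simp
      then show ?case using elim(1) by (rule v_diff_trans[OF R])
    qed
    then show ?thesis by (simp add: mem)
  qed (use ij in simp)
  show ?thesis
  proof (cases "\<exists>i j. i \<noteq> j \<and> cls (t i) \<in> B \<and> cls (t j) \<in> B")
    case True
    then have "{k. cls (t k) \<notin> B} = {}" using all by blast
    then show ?thesis by (metis finite.emptyI)
  next
    case False
    have "finite {i. cls (t i) \<in> B}"
    proof (cases "{i. cls (t i) \<in> B} = {}")
      case True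
      then show ?thesis by (metis finite.emptyI)
    next
      case ne: False
      then obtain i where "cls (t i) \<in> B" by blast
      with False have "{i. cls (t i) \<in> B} \<subseteq> {i}" by blast
      then show ?thesis using finite_subset by blast
    qed
    then show ?thesis ..
  qed
qed

text \<open>The finite and cofinite sets of indices are closed under complements and unions.\<close>

lemma bool_comb_equidistant:
  assumes "S \<in> bool_combs (univ upow) (div_balls upow)"
    and t: "\<And>i j. i \<noteq> j \<Longrightarrow> eventually (\<lambda>n. v (t i n - t j n) = \<rho> n) F"
  shows "finite {i. cls (t i) \<in> S} \<or> finite {i. cls (t i) \<notin> S}"
  using assms(1)
proof induction
  case (basic B)
  then show ?case using t by (rule div_ball_equidistant)
next
  case (compl A)
  then show ?case by (auto simp: univ_upow)
next
  case (union A B)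
  then show ?case by (auto simp: Collect_conj_eq Collect_disj_eq)
qed

text \<open>
  A ball with a nonstandard radius may meet the diagonal copy of the field in a cut that is not
  a ball, but it still contains this copy or meets it in a bounded set.
\<close>

lemma div_ball_const_near_infinity:
  assumes B: "B \<in> div_balls upow"
  shows "const_near_infinity (\<lambda>x. cls (\<lambda>n. x) \<in> B)"
proof (cases "(\<forall>x. cls (\<lambda>n. x) \<in> B) \<or> (\<forall>x. cls (\<lambda>n. x) \<notin> B)")
  case True
  then show ?thesis unfolding const_near_infinity_def by (metis one_neq_zero)
next
  case False
  then obtain b x0 where b: "cls (\<lambda>n. b) \<in> B" and x0: "cls (\<lambda>n. x0) \<notin> B" by blast
  then obtain a c R where R: "R = (\<le>) \<or> R = (<)"
    and mem: "\<And>x. cls x \<in> B \<longleftrightarrow> eventually (\<lambda>n. R (v (c n)) (v (x n - a n))) F"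
    using div_balls_upow[OF B] by (auto simp: univ_upow)
  \<comment> \<open>If a point of the ball were at least as far from \<open>b\<close> as
    \<open>x0\<close> is, then \<open>x0\<close> would belong to the ball too.\<close>
  have less: "v (x0 - b) < v (x - b)" if x: "cls (\<lambda>n. x) \<in> B" for x
  proof (rule ccontr)
    assume "\<not> v (x0 - b) < v (x - b)"
    then have le: "v (x - b) \<le> v (x0 - b)" by simp
    have "eventually (\<lambda>n. R (v (c n)) (v (x0 - a n))) F"
      using x[unfolded mem] b[unfolded mem]
    proof eventually_elim
      case (elim n)
      from elim(2) have "R (v (c n)) (v (a n - b))" by (simp add: v_diff_commute)
      with elim(1) have "R (v (c n)) (v (x - b))" by (rule v_diff_trans[OF R])
      with le R have "R (v (c n)) (v (x0 - b))" by auto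
      then show ?case using elim(2) by (rule v_diff_trans[OF R])
    qed
    with x0 show False by (simp add: mem)
  qed
  have "x0 - b \<noteq> 0" using b x0 by auto
  \<comment> \<open>The valuation of \<open>e\<close> is the minimum of \<open>v (x0 - b)\<close>
    and \<open>v b\<close>, so the closed ball around 0 with radius \<open>v e\<close> contains
    every diagonal point of \<open>B\<close>.\<close>
  define e where "e = (if b = 0 \<or> v (x0 - b) \<le> v b then x0 - b else b)"
  have e: "e \<noteq> 0" "v e \<le> v (x0 - b)" "v e \<le> v b"
    using \<open>x0 - b \<noteq> 0\<close> by (auto simp: e_def v_0)
  have "v e \<le> v x" if "cls (\<lambda>n. x) \<in> B" for x
  proof -
    have "v e \<le> v (x - b)" using less[OF that] e(2) by simp
    moreover have "v e \<le> v (b - 0)" using e(3) by simp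
    ultimately have "v e \<le> v (x - 0)" using v_diff_trans[of "(\<le>)"] by blast
    then show ?thesis by simp
  qed
  then show ?thesis
    using e(1) unfolding const_near_infinity_def by (meson not_le)
qed

lemma bool_comb_const_near_infinity:
  assumes "S \<in> bool_combs (univ upow) (div_balls upow)"
  shows "const_near_infinity (\<lambda>x. cls (\<lambda>n. x) \<in> S)"
  using assms
proof induction
  case (basic B)
  then show ?case by (rule div_ball_const_near_infinity)
next
  case (compl A)
  then show ?case by (auto simp: univ_upow const_near_infinity_def)
next
  case (union A B)
  then obtain d e
    where d: "d \<noteq> 0" "(\<forall>x. v x < v d \<longrightarrow> cls (\<lambda>n. x) \<in> A) \<or> (\<forall>x. v x < v d \<longrightarrow> cls (\<lambda>n. x) \<notin> A)"
      and e: "e \<noteq> 0" "(\<forall>x. v x < v e \<longrightarrow> cls (\<lambda>n. x) \<in> B) \<or> (\<forall>x. v x < v e \<longrightarrow> cls (\<lambda>n. x) \<notin> B)"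
    unfolding const_near_infinity_def by blast
  then obtain m where "m \<noteq> 0" "v m \<le> v d" "v m \<le> v e"
    using common_radius by blast
  then have "m \<noteq> 0" "\<And>x. v x < v m \<Longrightarrow> v x < v d" "\<And>x. v x < v m \<Longrightarrow> v x < v e"
    by auto
  then show ?case
    unfolding const_near_infinity_def using d(2) e(2) by (intro exI[of _ m]) blast
qed

lemma definable_set_upow:
  assumes "wf_fm L \<psi>"
  shows "definable_set L upow {X \<in> univ upow. sat upow ((\<lambda>i. cls (s i))(0 := X)) \<psi>}"
  unfolding definable_set_def definable_def
proof (intro exI conjI)
  have "(\<lambda>i. if i < 1 then [X] ! i else cls (s i)) = (\<lambda>i. cls (s i))(0 := X)" for X
    by (auto simp: fun_eq_iff)
  then show "{[x] |x. x \<in> {X \<in> univ upow. sat upow ((\<lambda>i. cls (s i))(0 := X)) \<psi>}} =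
      {xs. length xs = 1 \<and> set xs \<subseteq> univ upow \<and>
        sat upow (\<lambda>i. if i < 1 then xs ! i else cls (s i)) \<psi>}"
    by (auto simp: length_Suc_conv simp del: fun_upd_apply)
qed (use assms in \<open>auto simp: univ_upow\<close>)

end

lemma inj_sequence_in_finite:
  assumes "n \<le> card A"
  shows "\<exists>y :: nat \<Rightarrow> 'a. inj_on y {..<n} \<and> (\<forall>i<n. y i \<in> A)"
proof (cases "n = 0")
  case True
  then show ?thesis by auto
next
  case False
  with assms have "finite A" by (metis card.infinite le_zero_eq)
  then obtain h where "bij_betw h {0..<card A} A" using ex_bij_betw_nat_finite by blast
  then show ?thesis
    using assms by (intro exI[of _ h]) (auto simp: bij_betw_def intro: inj_on_subset)
qed

section \<open>Consequences of C-minimality for the field itself\<close>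

locale C_minimal_field = valued v
  for L :: "('f vf_fsym, 'r vf_rsym) language"
    and M :: "('f vf_fsym, 'r vf_rsym, 'a::alg_closed_field) fo_structure"
    and v :: "'a \<Rightarrow> 'g::linordered_ab_group_add extended" +
  assumes C_minimal_valued_field: "C_minimal_valued_field L M v"
begin

lemma univ_M: "univ M = UNIV"
  and expands: "expands_valued_field M v"
  using C_minimal_valued_field
  by (auto simp: C_minimal_valued_field_def expands_valued_field_def)

lemma ultrapower_exists: "\<exists>F. valued_ultrapower F M v"
proof -
  obtain F :: "nat filter" where "F \<le> sequentially"
    "\<And>P. eventually (\<lambda>n. \<not> P n) F \<longleftrightarrow> \<not> eventually P F"
    using nonprincipal_ultrafilter_exists by blast
  then have "valued_ultrapower F M v"
    by unfold_locales (use univ_M expands in auto)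
  then show ?thesis ..
qed

text \<open>C-minimality enters here, applied to the ultrapower as an elementarily equivalent
  structure.\<close>

lemma bool_comb_upow:
  assumes "valued_ultrapower F M v" "wf_fm L \<psi>"
  shows "{X \<in> univ (ultrapower.upow F M).
       sat (ultrapower.upow F M) ((\<lambda>i. ultrapower.cls F (s i))(0 := X)) \<psi>}
     \<in> bool_combs (univ (ultrapower.upow F M)) (div_balls (ultrapower.upow F M))"
proof -
  interpret valued_ultrapower F M v by fact
  show ?thesis
    using C_minimal_valued_field definable_set_upow[OF assms(2)]
      is_structure_upow[of L] elem_equiv_upow[of L]
    unfolding C_minimal_valued_field_def C_minimal_def by blast
qed

text \<open>The field is embedded diagonally into an ultrapower, where the set defined by
  \<open>\<psi>\<close> is a boolean combination of balls; on constant sequences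
  \<open>\<psi>\<close> keeps its truth value.\<close>

lemma sat_const_near_infinity:
  assumes "wf_fm L \<psi>"
  shows "const_near_infinity (\<lambda>x. sat M (\<sigma>(0 := x)) \<psi>)"
proof -
  obtain F where F: "valued_ultrapower F M v" using ultrapower_exists by blast
  then interpret valued_ultrapower F M v .
  have "sat upow ((\<lambda>i. cls (\<lambda>n. \<sigma> i))(0 := cls (\<lambda>n. x))) \<psi> \<longleftrightarrow> sat M (\<sigma>(0 := x)) \<psi>" for x
  proof -
    have "sat upow ((\<lambda>i. cls (\<lambda>n. \<sigma> i))(0 := cls (\<lambda>n. x))) \<psi> \<longleftrightarrow>
        eventually (\<lambda>n. sat M (\<sigma>(0 := x)) \<psi>) F"
      unfolding cls_fun_upd los by (rule arg_cong[of _ _ "\<lambda>P. eventually P F"])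
        (auto intro!: ext arg_cong[of _ _ "\<lambda>s. sat M s \<psi>"])
    then show ?thesis
      using F_nontrivial by (cases "sat M (\<sigma>(0 := x)) \<psi>") simp_all
  qed
  then show ?thesis
    using bool_comb_const_near_infinity[OF bool_comb_upow[OF F assms, of "\<lambda>i n. \<sigma> i"]]
    by (simp add: univ_upow)
qed

text \<open>Without a uniform bound, counterexamples for all \<open>N\<close> combine in an
  ultrapower into an infinite equidistant family that a definable set splits into two infinite
  parts.\<close>

lemma sat_equidistant:
  assumes wf: "wf_fm L \<psi>"
  shows "\<exists>N. \<forall>\<sigma> T. finite T \<longrightarrow> equidistant T \<longrightarrow>
    card {t \<in> T. sat M (\<sigma>(0 := t)) \<psi>} < N \<or> card {t \<in> T. \<not> sat M (\<sigma>(0 := t)) \<psi>} < N"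
proof (rule ccontr)
  assume "\<not> ?thesis"
  then have "\<forall>N. \<exists>\<sigma> T. equidistant T \<and> N \<le> card {t \<in> T. sat M (\<sigma>(0 := t)) \<psi>} \<and>
      N \<le> card {t \<in> T. \<not> sat M (\<sigma>(0 := t)) \<psi>}"
    by (meson not_less)
  from choice[OF this] obtain \<sigma> where "\<forall>N. \<exists>T. equidistant T \<and>
      N \<le> card {t \<in> T. sat M ((\<sigma> N)(0 := t)) \<psi>} \<and>
      N \<le> card {t \<in> T. \<not> sat M ((\<sigma> N)(0 := t)) \<psi>}" ..
  from choice[OF this] obtain T where T: "\<forall>N. equidistant (T N) \<and>
      N \<le> card {t \<in> T N. sat M ((\<sigma> N)(0 := t)) \<psi>} \<and>
      N \<le> card {t \<in> T N. \<not> sat M ((\<sigma> N)(0 := t)) \<psi>}" ..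
  then have eq: "\<And>N. equidistant (T N)"
    and c1: "\<And>N. N \<le> card {t \<in> T N. sat M ((\<sigma> N)(0 := t)) \<psi>}"
    and c2: "\<And>N. N \<le> card {t \<in> T N. \<not> sat M ((\<sigma> N)(0 := t)) \<psi>}"
    by blast+
  have "\<forall>n. \<exists>y. inj_on y {..<n} \<and> (\<forall>i<n. y i \<in> {t \<in> T n. sat M ((\<sigma> n)(0 := t)) \<psi>})"
    by (intro allI inj_sequence_in_finite c1)
  from choice[OF this] obtain y where y: "\<And>n. inj_on (y n) {..<n}"
    "\<And>n i. i < n \<Longrightarrow> y n i \<in> T n \<and> sat M ((\<sigma> n)(0 := y n i)) \<psi>"
    by (auto simp del: fun_upd_apply)
  have "\<forall>n. \<exists>z. inj_on z {..<n} \<and> (\<forall>i<n. z i \<in> {t \<in> T n. \<not> sat M ((\<sigma> n)(0 := t)) \<psi>})"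
    by (intro allI inj_sequence_in_finite c2)
  from choice[OF this] obtain z where z: "\<And>n. inj_on (z n) {..<n}"
    "\<And>n i. i < n \<Longrightarrow> z n i \<in> T n \<and> \<not> sat M ((\<sigma> n)(0 := z n i)) \<psi>"
    by (auto simp del: fun_upd_apply)
  obtain \<rho> where \<rho>: "\<And>n x y. x \<in> T n \<Longrightarrow> y \<in> T n \<Longrightarrow> x \<noteq> y \<Longrightarrow> v (x - y) = \<rho> n"
    using eq unfolding equidistant_def by metis
  \<comment> \<open>The two enumerations are interleaved: even indices satisfy
    \<open>\<psi>\<close>, odd ones do not. Only the indices below \<open>n\<close> are meaningful
    at \<open>n\<close>, and each fixed index is below almost all \<open>n\<close>.\<close>
  define t where "t i n = (if even i then y n (i div 2) else z n (i div 2))" for i n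
  have tT: "t i n \<in> T n" and sat_t: "sat M ((\<sigma> n)(0 := t i n)) \<psi> \<longleftrightarrow> even i" if "i < n" for i n
    using y(2)[of "i div 2" n] z(2)[of "i div 2" n] that by (auto simp: t_def)
  have t_inj: "t i n \<noteq> t j n" if "i \<noteq> j" "i < n" "j < n" for i j n
  proof (cases "even i = even j")
    case True
    with that have "i div 2 \<noteq> j div 2" by presburger
    moreover have "i div 2 < n" "j div 2 < n" using that by auto
    ultimately show ?thesis
      using True that inj_onD[OF y(1)[of n], of "i div 2" "j div 2"]
        inj_onD[OF z(1)[of n], of "i div 2" "j div 2"] by (auto simp: t_def)
  next
    case False
    then show ?thesis using sat_t[of i n] sat_t[of j n] that by metis
  qed
  obtain F where F: "valued_ultrapower F M v" using ultrapower_exists by blast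
  then interpret valued_ultrapower F M v .
  let ?S = "{X \<in> univ upow. sat upow ((\<lambda>i. cls (\<lambda>n. \<sigma> n i))(0 := X)) \<psi>}"
  have mem: "cls (t i) \<in> ?S \<longleftrightarrow> even i" for i
  proof -
    have "sat upow ((\<lambda>i. cls (\<lambda>n. \<sigma> n i))(0 := cls (t i))) \<psi> \<longleftrightarrow>
        eventually (\<lambda>n. sat M ((\<sigma> n)(0 := t i n)) \<psi>) F"
      unfolding cls_fun_upd los by (rule arg_cong[of _ _ "\<lambda>P. eventually P F"])
        (auto intro!: ext arg_cong[of _ _ "\<lambda>s. sat M s \<psi>"])
    also have "\<dots> \<longleftrightarrow> eventually (\<lambda>n. even i) F"
      by (rule eventually_cong[OF eventually_F_gt[of i]]) (rule sat_t)
    also have "\<dots> \<longleftrightarrow> even i"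
      using F_nontrivial by (cases "even i") simp_all
    finally show ?thesis by (simp add: univ_upow)
  qed
  have "finite {i. cls (t i) \<in> ?S} \<or> finite {i. cls (t i) \<notin> ?S}"
  proof (rule bool_comb_equidistant[OF bool_comb_upow[OF F wf]])
    fix i j :: nat assume ij: "i \<noteq> j"
    show "eventually (\<lambda>n. v (t i n - t j n) = \<rho> n) F"
      using eventually_F_gt[of i] eventually_F_gt[of j]
      by eventually_elim (intro \<rho> tT t_inj ij)
  qed
  moreover have "infinite {i :: nat. even i}"
    by (rule infinite_super[OF _ range_inj_infinite[of "\<lambda>i. 2 * i"]]) (auto simp: inj_def)
  moreover have "infinite {i :: nat. odd i}"
    by (rule infinite_super[OF _ range_inj_infinite[of "\<lambda>i. 2 * i + 1"]]) (auto simp: inj_def)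
  ultimately show False unfolding mem by blast
qed

end

section \<open>Values of a definable function near infinity\<close>

context valued
begin

text \<open>In an ultrametric triangle the two longest sides have equal length, and here the side
  from \<open>z\<close> to \<open>y\<close> is strictly shorter than that from \<open>y\<close> to
  \<open>w\<close>.\<close>

lemma v_diff_perturb:
  assumes "v (y - w) < v (z - y)"
  shows "v (z - w) = v (y - w)"
proof (rule antisym)
  show "v (y - w) \<le> v (z - w)"
    using v_diff_trans[of "(\<le>)" "v (y - w)" z y w] assms by simp
  show "v (z - w) \<le> v (y - w)"
  proof (rule ccontr)
    assume "\<not> ?thesis"
    then have "v (y - w) < v (y - w)"
      using v_diff_trans[of "(<)" "v (y - w)" y z w] assms by (simp add: v_diff_commute[of y z] not_le)
    then show False by simp
  qed
qed

lemma v_prod_neg: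
  assumes "finite A" "A \<noteq> {}" "\<And>a. a \<in> A \<Longrightarrow> v (g a) < 0"
  shows "v (\<Prod>a\<in>A. g a) < 0"
  using assms
proof (induction A rule: finite_ne_induct)
  case (insert a A)
  then have "v (g a) < 0" "v (\<Prod>a\<in>A. g a) < 0" by auto
  moreover from this have "g a \<noteq> 0" "(\<Prod>a\<in>A. g a) \<noteq> 0"
    by (metis v_0 less_extended_simps(4))+
  ultimately show ?case
    using insert.hyps v_Fin[of "g a"] v_Fin[of "\<Prod>a\<in>A. g a"]
    by (auto simp: v_mult zero_extended_def intro: add_neg_neg)
qed simp

lemma v_prod_nonneg: "(\<And>a. a \<in> A \<Longrightarrow> 0 \<le> v (g a)) \<Longrightarrow> 0 \<le> v (\<Prod>a\<in>A. g a)"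
proof (induction A rule: infinite_finite_induct)
  case (insert a A)
  then have "0 \<le> v (g a) + v (\<Prod>a\<in>A. g a)"
    using add_mono[of 0 "v (g a)" 0 "v (\<Prod>a\<in>A. g a)"] by simp
  with insert.hyps show ?case by (simp add: v_mult)
qed (simp_all add: v_1)

end

context C_minimal_field
begin

text \<open>A root of \<open>\<Prod>(X - a) - 1\<close> lies in a new residue class.\<close>

lemma new_residue:
  assumes A: "finite A" "A \<noteq> {}" "\<And>a. a \<in> A \<Longrightarrow> 0 \<le> v a"
  shows "\<exists>b. \<forall>a\<in>A. v (b - a) = 0"
proof -
  let ?p = "(\<Prod>a\<in>A. [:- a, 1:]) + [:- 1:]"
  have "degree (\<Prod>a\<in>A. [:- a, 1:]) = card A"
    by (subst degree_prod_eq_sum_degree) auto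
  then have "degree ?p = card A"
    using A by (subst degree_add_eq_left) (auto simp: card_gt_0_iff)
  then obtain b where "poly ?p b = 0"
    using alg_closed_imp_poly_has_root[of ?p] A by (auto simp: card_gt_0_iff)
  then have prod: "(\<Prod>a\<in>A. b - a) = 1"
    by (simp add: poly_prod)
  \<comment> \<open>With a negative valuation of \<open>b\<close> all factors \<open>b - a\<close>,
    and hence their product 1, would have negative valuation.\<close>
  have "0 \<le> v b"
  proof (rule ccontr)
    assume b: "\<not> 0 \<le> v b"
    have "v (b - a) < 0" if "a \<in> A" for a
    proof (rule ccontr)
      assume "\<not> v (b - a) < 0"
      then have "0 \<le> v (b - 0)"
        using v_diff_trans[of "(\<le>)" 0 b a 0] A(3)[OF that] by simp
      with b show False by simp
    qed
    then have "v (\<Prod>a\<in>A. b - a) < 0" using A by (intro v_prod_neg) auto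
    then show False by (simp add: prod v_1)
  qed
  have nonneg: "0 \<le> v (b - a)" if "a \<in> A" for a
    using v_diff_trans[of "(\<le>)" 0 b 0 a] A(3)[OF that] \<open>0 \<le> v b\<close> by (simp add: v_minus)
  \<comment> \<open>Nonnegative valuations of the factors add up to \<open>v 1 = 0\<close>, so each
    of them vanishes.\<close>
  have "v (b - c) = 0" if c: "c \<in> A" for c
  proof -
    have "1 = (b - c) * (\<Prod>a\<in>A - {c}. b - a)"
      using prod.remove[OF A(1) c, of "\<lambda>a. b - a"] prod by simp
    then have "0 = v (b - c) + v (\<Prod>a\<in>A - {c}. b - a)"
      by (metis v_mult v_1)
    moreover have "0 \<le> v (\<Prod>a\<in>A - {c}. b - a)"
      using nonneg by (intro v_prod_nonneg) auto
    moreover have "v (b - c) \<le> v (b - c) + v (\<Prod>a\<in>A - {c}. b - a)"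
      using calculation(2) add_mono[of "v (b - c)" "v (b - c)" 0] by simp
    ultimately show ?thesis using nonneg[OF c] by simp
  qed
  then show ?thesis by blast
qed

lemma residues_exist:
  "\<exists>A. finite A \<and> card A = n \<and> (\<forall>a\<in>A. v a = 0) \<and> (\<forall>a\<in>A. \<forall>b\<in>A. a \<noteq> b \<longrightarrow> v (a - b) = 0)"
proof (induction n)
  case 0
  show ?case by (rule exI[of _ "{}"]) simp
next
  case (Suc n)
  then obtain A where A: "finite A" "card A = n" "\<forall>a\<in>A. v a = 0"
    "\<forall>a\<in>A. \<forall>b\<in>A. a \<noteq> b \<longrightarrow> v (a - b) = 0" by blast
  \<comment> \<open>Inserting 0 makes the set nonempty and forces \<open>v b = 0\<close>.\<close>
  then obtain b where b: "\<forall>a\<in>insert 0 A. v (b - a) = 0"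
    using new_residue[of "insert 0 A"] by (metis empty_iff finite_insert insert_iff le_Pinf order_refl v_0)
  have "b \<notin> A"
    using b by (auto simp: v_0 zero_extended_def)
  then show ?case
    using A b by (intro exI[of _ "insert b A"]) (auto simp: v_diff_commute v_minus)
qed

text \<open>By nontriviality some element or its inverse has negative valuation; multiplying
  \<open>e\<close> by it lowers the valuation.\<close>

lemma unbounded:
  assumes "e \<noteq> 0"
  shows "\<exists>x. v x < v e"
proof -
  obtain b where b: "b \<noteq> 0" "v b \<noteq> 0"
    using C_minimal_valued_field
    by (auto simp: C_minimal_valued_field_def nontrivial_valuation_def)
  have "v b + v (inverse b) = 0"
    using b v_mult[of b "inverse b"] v_1 by simp
  moreover obtain \<gamma> \<delta> where \<gamma>: "v b = Fin \<gamma>" "v (inverse b) = Fin \<delta>"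
    using b v_Fin[of b] v_Fin[of "inverse b"] by auto
  ultimately have "\<delta> = - \<gamma>"
    by (simp add: zero_extended_def eq_neg_iff_add_eq_0 add.commute)
  with \<gamma> b have "v b < 0 \<or> v (inverse b) < 0"
    by (auto simp: zero_extended_def)
  then have "\<exists>c. v c < 0" by blast
  then obtain c where c: "v c < 0" by blast
  then have "c \<noteq> 0" by (metis v_0 less_extended_simps(4))
  with c assms have "v (e * c) < v e"
    using v_Fin[of c] v_Fin[of e] by (auto simp: v_mult zero_extended_def)
  then show ?thesis ..
qed

end

section \<open>Renaming of variables in formulas\<close>

fun shift_trm :: "nat \<Rightarrow> 'f trm \<Rightarrow> 'f trm" where
  "shift_trm k (Var i) = Var (i + k)"
| "shift_trm k (App f ts) = App f (map (shift_trm k) ts)"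

fun shift_fm :: "nat \<Rightarrow> ('f, 'r) fm \<Rightarrow> ('f, 'r) fm" where
  "shift_fm k (Eq s t) = Eq (shift_trm k s) (shift_trm k t)"
| "shift_fm k (Atom r ts) = Atom r (map (shift_trm k) ts)"
| "shift_fm k (Neg \<phi>) = Neg (shift_fm k \<phi>)"
| "shift_fm k (Conj \<phi> \<psi>) = Conj (shift_fm k \<phi>) (shift_fm k \<psi>)"
| "shift_fm k (Ex i \<phi>) = Ex (i + k) (shift_fm k \<phi>)"

lemma wf_shift_trm: "wf_trm L (shift_trm k t) \<longleftrightarrow> wf_trm L t"
  by (induction t) auto

lemma wf_shift_fm: "wf_fm L (shift_fm k \<phi>) \<longleftrightarrow> wf_fm L \<phi>"
  by (induction \<phi>) (auto simp: wf_shift_trm)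

lemma eval_shift_trm: "eval_trm M \<sigma> (shift_trm k t) = eval_trm M (\<lambda>i. \<sigma> (i + k)) t"
proof (induction t)
  case (App f ts)
  then have "map (eval_trm M \<sigma> \<circ> shift_trm k) ts = map (eval_trm M (\<lambda>i. \<sigma> (i + k))) ts"
    by simp
  then show ?case by (simp del: map_eq_conv)
qed simp

lemma sat_shift_fm: "sat M \<sigma> (shift_fm k \<phi>) \<longleftrightarrow> sat M (\<lambda>i. \<sigma> (i + k)) \<phi>"
proof (induction \<phi> arbitrary: \<sigma>)
  case (Atom r ts)
  have "map (eval_trm M \<sigma> \<circ> shift_trm k) ts = map (eval_trm M (\<lambda>i. \<sigma> (i + k))) ts"
    by (simp add: eval_shift_trm)
  then show ?case by (simp del: map_eq_conv)
next
  case (Ex i \<phi>)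
  have "(\<lambda>j. (\<sigma>(i + k := a)) (j + k)) = (\<lambda>j. \<sigma> (j + k))(i := a)" for a
    by auto
  then show ?case by (simp add: Ex.IH del: fun_upd_apply)
qed (simp_all add: eval_shift_trm)

text \<open>
  The graph of \<open>f\<close> is defined by \<open>\<phi>\<close>, with parameters \<open>\<tau>\<close>. Shifting the variables of \<open>\<phi>\<close> by
  \<open>10\<close> makes room for the variables of other formulas, while the parameters are read from
  the assignments \<open>\<sigma>\<close> with \<open>admissible \<sigma>\<close>.
\<close>

locale definable_function = C_minimal_field L M v
  for L :: "('f vf_fsym, 'r vf_rsym) language"
    and M :: "('f vf_fsym, 'r vf_rsym, 'a::alg_closed_field) fo_structure"
    and v :: "'a \<Rightarrow> 'g::linordered_ab_group_add extended" +
  fixes X :: "'a set" and f :: "'a \<Rightarrow> 'a"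
    and \<phi> :: "('f vf_fsym, 'r vf_rsym) fm" and \<tau> :: "nat \<Rightarrow> 'a"
  assumes wf_\<phi>: "wf_fm L \<phi>"
    and sat_\<phi>: "\<And>x y. sat M (\<lambda>i. if i = 0 then x else if i = 1 then y else \<tau> i) \<phi> \<longleftrightarrow>
                  x \<in> X \<and> y = f x"
begin

text \<open>Variables 0 and 1 of \<open>\<phi>\<close> become 10 and 11 and remain free to be
  assigned, so only the variables from 12 on are prescribed.\<close>

definition admissible :: "(nat \<Rightarrow> 'a) \<Rightarrow> bool" where
  "admissible \<sigma> \<longleftrightarrow> (\<forall>i\<ge>2. \<sigma> (i + 10) = \<tau> i)"

text \<open>Closure rules for predicates on assignments replace the explicit construction of
  formulas.\<close>

definition expressible :: "((nat \<Rightarrow> 'a) \<Rightarrow> bool) \<Rightarrow> bool" where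
  "expressible P \<longleftrightarrow> (\<exists>\<psi>. wf_fm L \<psi> \<and> (\<forall>\<sigma>. admissible \<sigma> \<longrightarrow> (sat M \<sigma> \<psi> \<longleftrightarrow> P \<sigma>)))"

lemma admissible_upd: "admissible \<sigma> \<Longrightarrow> i < 12 \<Longrightarrow> admissible (\<sigma>(i := a))"
  by (auto simp: admissible_def)

lemma admissible_\<tau>: "admissible (\<lambda>i. \<tau> (i - 10))"
  by (simp add: admissible_def)

lemma syms_L: "(Sub, 2) \<in> fsyms L" "(Div, 2) \<in> rsyms L"
  using C_minimal_valued_field
  by (auto simp: C_minimal_valued_field_def sublanguage_def L_div_def)

lemma expressible_not: "expressible P \<Longrightarrow> expressible (\<lambda>\<sigma>. \<not> P \<sigma>)"
  unfolding expressible_def by (metis sat.simps(3) wf_fm.simps(3))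

lemma expressible_conj: "expressible P \<Longrightarrow> expressible Q \<Longrightarrow> expressible (\<lambda>\<sigma>. P \<sigma> \<and> Q \<sigma>)"
  unfolding expressible_def by (metis sat.simps(4) wf_fm.simps(4))

lemma expressible_imp: "expressible P \<Longrightarrow> expressible Q \<Longrightarrow> expressible (\<lambda>\<sigma>. P \<sigma> \<longrightarrow> Q \<sigma>)"
  using expressible_not[OF expressible_conj[OF _ expressible_not], of P Q] by simp

lemma expressible_ex:
  assumes "expressible P" "i < 12"
  shows "expressible (\<lambda>\<sigma>. \<exists>a. P (\<sigma>(i := a)))"
proof -
  obtain \<psi> where "wf_fm L \<psi>" "\<And>\<sigma>. admissible \<sigma> \<Longrightarrow> sat M \<sigma> \<psi> \<longleftrightarrow> P \<sigma>"
    using assms(1) by (auto simp: expressible_def)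
  then show ?thesis
    unfolding expressible_def using admissible_upd[OF _ assms(2)]
    by (intro exI[of _ "Ex i \<psi>"]) (simp add: univ_M del: fun_upd_apply)
qed

lemma expressible_all:
  assumes "expressible P" "i < 12"
  shows "expressible (\<lambda>\<sigma>. \<forall>a. P (\<sigma>(i := a)))"
  using expressible_not[OF expressible_ex[OF expressible_not[OF assms(1)] assms(2)]] by simp

lemma expressible_eq: "expressible (\<lambda>\<sigma>. \<sigma> i = \<sigma> j)"
  unfolding expressible_def by (rule exI[of _ "Eq (Var i) (Var j)"]) simp

lemma expressible_v_le: "expressible (\<lambda>\<sigma>. v (\<sigma> i) \<le> v (\<sigma> j))"
  unfolding expressible_def using syms_L expands
  by (intro exI[of _ "Atom Div [Var i, Var j]"])
    (simp add: expands_valued_field_def numeral_2_eq_2)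

lemma expressible_v_diff_le: "expressible (\<lambda>\<sigma>. v (\<sigma> i - \<sigma> j) \<le> v (\<sigma> k))"
  unfolding expressible_def using syms_L expands
  by (intro exI[of _ "Atom Div [App Sub [Var i, Var j], Var k]"])
    (simp add: expands_valued_field_def numeral_2_eq_2)

lemma expressible_graph:
  assumes "i < 10" "j < 10"
  shows "expressible (\<lambda>\<sigma>. \<sigma> i \<in> X \<and> \<sigma> j = f (\<sigma> i))"
proof -
  \<comment> \<open>The arguments are copied into variables 10 and 11, where the shifted formula
    expects them; \<open>i\<close> and \<open>j\<close> below 10 are not captured.\<close>
  let ?\<psi> = "Ex 10 (Ex 11 (Conj (Conj (Eq (Var 10) (Var i)) (Eq (Var 11) (Var j))) (shift_fm 10 \<phi>)))"
  have "sat M \<sigma> ?\<psi> \<longleftrightarrow> \<sigma> i \<in> X \<and> \<sigma> j = f (\<sigma> i)" if "admissible \<sigma>" for \<sigma>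
  proof -
    have "(\<lambda>k. (\<sigma>(10 := \<sigma> i, 11 := \<sigma> j)) (k + 10)) =
        (\<lambda>k. if k = 0 then \<sigma> i else if k = 1 then \<sigma> j else \<tau> k)"
      using that by (auto simp: admissible_def fun_eq_iff)
    then have "sat M (\<sigma>(10 := \<sigma> i, 11 := \<sigma> j)) (shift_fm 10 \<phi>) \<longleftrightarrow> \<sigma> i \<in> X \<and> \<sigma> j = f (\<sigma> i)"
      using sat_\<phi>[of "\<sigma> i" "\<sigma> j"] by (simp only: sat_shift_fm)
    then show ?thesis using assms by (auto simp: univ_M)
  qed
  then show ?thesis
    unfolding expressible_def using wf_\<phi> by (intro exI[of _ ?\<psi>]) (auto simp: wf_shift_fm)
qed

lemma expressible_const_near_infinity:
  assumes "expressible P" "admissible \<sigma>"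
  shows "const_near_infinity (\<lambda>x. P (\<sigma>(0 := x)))"
proof -
  obtain \<psi> where "wf_fm L \<psi>" "\<And>\<sigma>. admissible \<sigma> \<Longrightarrow> sat M \<sigma> \<psi> \<longleftrightarrow> P \<sigma>"
    using assms(1) by (auto simp: expressible_def)
  then show ?thesis
    using sat_const_near_infinity[of \<psi> \<sigma>] admissible_upd[OF assms(2), of 0] by simp
qed

lemma expressible_equidistant:
  assumes "expressible P"
  shows "\<exists>N. \<forall>\<sigma> T. admissible \<sigma> \<longrightarrow> finite T \<longrightarrow> equidistant T \<longrightarrow>
    card {t \<in> T. P (\<sigma>(0 := t))} < N \<or> card {t \<in> T. \<not> P (\<sigma>(0 := t))} < N"
proof -
  obtain \<psi> where wf: "wf_fm L \<psi>" and sat: "\<And>\<sigma>. admissible \<sigma> \<Longrightarrow> sat M \<sigma> \<psi> \<longleftrightarrow> P \<sigma>"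
    using assms(1) by (auto simp: expressible_def)
  obtain N where N: "\<forall>\<sigma> T. finite T \<longrightarrow> equidistant T \<longrightarrow>
      card {t \<in> T. sat M (\<sigma>(0 := t)) \<psi>} < N \<or> card {t \<in> T. \<not> sat M (\<sigma>(0 := t)) \<psi>} < N"
    using sat_equidistant[OF wf] ..
  have "P (\<sigma>(0 := t)) \<longleftrightarrow> sat M (\<sigma>(0 := t)) \<psi>" if "admissible \<sigma>" for \<sigma> t
    using sat admissible_upd[OF that] by simp
  then show ?thesis
    using N by (intro exI[of _ N]) (simp del: fun_upd_apply)
qed

lemma expressible_definable:
  assumes "expressible P" "admissible \<sigma>"
  shows "definable L M 2 {[x, y] | x y. P (\<sigma>(0 := x, 1 := y))}"
proof -
  obtain \<psi> where wf: "wf_fm L \<psi>" and sat: "\<And>\<sigma>. admissible \<sigma> \<Longrightarrow> sat M \<sigma> \<psi> \<longleftrightarrow> P \<sigma>"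
    using assms(1) by (auto simp: expressible_def)
  have upd: "(\<lambda>i. if i < 2 then [x, y] ! i else \<sigma> i) = \<sigma>(0 := x, 1 := y)" for x y
    by (auto simp: fun_eq_iff less_2_cases_iff)
  have "P (\<sigma>(0 := x, 1 := y)) \<longleftrightarrow> sat M (\<lambda>i. if i < 2 then [x, y] ! i else \<sigma> i) \<psi>" for x y
    unfolding upd by (rule sat[symmetric]) (simp add: assms admissible_upd)
  then have "{[x, y] | x y. P (\<sigma>(0 := x, 1 := y))} = {xs. length xs = 2 \<and> set xs \<subseteq> univ M \<and>
      sat M (\<lambda>i. if i < 2 then xs ! i else \<sigma> i) \<psi>}"
    by (auto simp: univ_M length_Suc_conv numeral_2_eq_2 simp del: fun_upd_apply)
  then show ?thesis
    unfolding definable_def using wf by (intro exI[of _ \<psi>] exI[of _ \<sigma>]) (simp add: univ_M)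
qed

text \<open>Membership in \<open>X\<close> is included because the definable graph determines
  \<open>f\<close> only on \<open>X\<close>.\<close>

definition less_f :: "'a \<Rightarrow> 'a \<Rightarrow> bool" where
  "less_f x y \<longleftrightarrow> x \<in> X \<and> y \<in> X \<and> v (f x) < v (f y)"

text \<open>The order and its converse are treated together, so that domination from below and from
  above needs a single argument.\<close>

definition comparison :: "('a \<Rightarrow> 'a \<Rightarrow> bool) \<Rightarrow> bool" where
  "comparison R \<longleftrightarrow> R = less_f \<or> R = (\<lambda>x y. less_f y x)"

lemma expressible_less_f:
  assumes "i < 8" "j < 8"
  shows "expressible (\<lambda>\<sigma>. less_f (\<sigma> i) (\<sigma> j))"
proof -
  \<comment> \<open>Variables 8 and 9 hold the values of \<open>f\<close> at the two points, whence
    the bound 8 on \<open>i\<close> and \<open>j\<close>.\<close>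
  have "expressible (\<lambda>\<sigma>. (\<sigma> i \<in> X \<and> \<sigma> 8 = f (\<sigma> i)) \<and> (\<sigma> j \<in> X \<and> \<sigma> 9 = f (\<sigma> j)) \<and>
      \<not> v (\<sigma> 9) \<le> v (\<sigma> 8))"
    using assms by (intro expressible_conj expressible_graph expressible_not expressible_v_le) auto
  from expressible_ex[OF expressible_ex[OF this, of 9], of 8] show ?thesis
    using assms by (simp add: less_f_def not_le conj_ac)
qed

lemma expressible_comparison:
  "comparison R \<Longrightarrow> i < 8 \<Longrightarrow> j < 8 \<Longrightarrow> expressible (\<lambda>\<sigma>. R (\<sigma> i) (\<sigma> j))"
  by (auto simp: comparison_def intro: expressible_less_f)

lemma comparison_irrefl: "comparison R \<Longrightarrow> \<not> R x x"
  by (auto simp: comparison_def less_f_def)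

lemma comparison_trans: "comparison R \<Longrightarrow> R x y \<Longrightarrow> R y z \<Longrightarrow> R x z"
  by (auto simp: comparison_def less_f_def)

text \<open>The point \<open>c\<close> is assigned to variable 1 as a parameter, so the bound is
  uniform in \<open>c\<close>.\<close>

lemma comparison_equidistant:
  assumes "comparison R"
  obtains N where "\<And>c T. finite T \<Longrightarrow> equidistant T \<Longrightarrow>
    card {t \<in> T. R t c} < N \<or> card {t \<in> T. \<not> R t c} < N"
proof -
  obtain N where N: "\<forall>\<sigma> T. admissible \<sigma> \<longrightarrow> finite T \<longrightarrow> equidistant T \<longrightarrow>
      card {t \<in> T. R ((\<sigma>(0 := t)) 0) ((\<sigma>(0 := t)) 1)} < N \<or>
      card {t \<in> T. \<not> R ((\<sigma>(0 := t)) 0) ((\<sigma>(0 := t)) 1)} < N"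
    using expressible_equidistant[OF expressible_comparison[OF assms, of 0 1]] by auto
  have "card {t \<in> T. R t c} < N \<or> card {t \<in> T. \<not> R t c} < N"
    if "finite T" "equidistant T" for c T
    using N[rule_format, OF admissible_upd[OF admissible_\<tau>, of 1 c] that] by simp
  then show ?thesis using that by blast
qed

section \<open>Dominating points\<close>

definition dominating :: "('a \<Rightarrow> 'a \<Rightarrow> bool) \<Rightarrow> 'a \<Rightarrow> bool" where
  "dominating R x \<longleftrightarrow> (\<exists>y. v y = v x \<and> (\<forall>z. v x < v (z - y) \<longrightarrow> R z x))"

lemma dominating_const_near_infinity:
  assumes "comparison R"
  shows "const_near_infinity (dominating R)"
proof -
  \<comment> \<open>Variables 0, 1 and 2 stand for \<open>x\<close>, \<open>y\<close> and
    \<open>z\<close> in \<open>dominating\<close>.\<close>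
  let ?Q = "\<lambda>\<sigma>. \<not> v (\<sigma> 2 - \<sigma> 1) \<le> v (\<sigma> 0) \<longrightarrow> R (\<sigma> 2) (\<sigma> 0)"
  have Q: "expressible ?Q"
    using assms by (intro expressible_imp expressible_not expressible_v_diff_le expressible_comparison) auto
  have "expressible (\<lambda>\<sigma>. (v (\<sigma> 1) \<le> v (\<sigma> 0) \<and> v (\<sigma> 0) \<le> v (\<sigma> 1)) \<and> (\<forall>z. ?Q (\<sigma>(2 := z))))"
    by (intro expressible_conj expressible_v_le expressible_all[OF Q]) simp
  from expressible_const_near_infinity[OF expressible_ex[OF this, of 1] admissible_\<tau>]
  have "const_near_infinity (\<lambda>x. \<exists>y. (v y \<le> v x \<and> v x \<le> v y) \<and> (\<forall>z. \<not> v (z - y) \<le> v x \<longrightarrow> R z x))"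
    by simp
  moreover have "dominating R =
      (\<lambda>x. \<exists>y. (v y \<le> v x \<and> v x \<le> v y) \<and> (\<forall>z. \<not> v (z - y) \<le> v x \<longrightarrow> R z x))"
    by (simp add: fun_eq_iff dominating_def not_le flip: order_eq_iff)
  ultimately show ?thesis by simp
qed

text \<open>
  If every \<open>x\<close> of valuation \<open>\<rho>\<close> dominates a whole residue class, then one can descend through
  pairwise distinct classes, and the chain is split into two large parts by its middle term.
\<close>

lemma not_all_dominating:
  assumes R: "comparison R" and x0: "v x0 = \<rho>" "\<rho> < Pinf"
    and dom: "\<And>x. v x = \<rho> \<Longrightarrow> dominating R x"
  shows False
proof -
  have "\<forall>x. \<exists>y. v x = \<rho> \<longrightarrow> v y = \<rho> \<and> (\<forall>z. \<rho> < v (z - y) \<longrightarrow> R z x)"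
    using dom unfolding dominating_def by metis
  from choice[OF this] obtain next_pt
    where next_pt: "\<And>x. v x = \<rho> \<Longrightarrow> v (next_pt x) = \<rho>"
      "\<And>x z. v x = \<rho> \<Longrightarrow> \<rho> < v (z - next_pt x) \<Longrightarrow> R z x"
    by auto
  define s where "s i = (next_pt ^^ i) x0" for i
  have v_s: "v (s i) = \<rho>" for i
    by (induction i) (auto simp: s_def x0 next_pt)
  have class_s: "R z (s i)" if "\<rho> < v (z - s (Suc i))" for i z
    using next_pt(2)[OF v_s[of i], of z] that by (simp add: s_def)
  have desc: "R (s j) (s i)" if "i < j" for i j
    using that
  proof (induction rule: less_Suc_induct)
    case (1 i)
    show ?case by (rule class_s) (simp add: v_0 x0)
  next
    case (2 i j k)
    then show ?case using comparison_trans[OF R] by blast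
  qed
  have dist_less: "v (s i - s j) = \<rho>" if ij: "i < j" for i j
  proof (rule antisym)
    show "\<rho> \<le> v (s i - s j)"
      using v_diff_trans[of "(\<le>)" \<rho> "s i" 0 "s j"] by (simp add: v_s v_minus)
    \<comment> \<open>If \<open>s i\<close> were in the class of \<open>s (Suc k)\<close> with
      \<open>i \<le> k\<close>, it would come strictly after \<open>s k\<close> in the descent,
      although \<open>s k\<close> equals \<open>s i\<close> or comes after it.\<close>
    show "v (s i - s j) \<le> \<rho>"
    proof (rule ccontr)
      assume "\<not> ?thesis"
      moreover obtain k where k: "j = Suc k" "i \<le> k" using ij by (cases j) auto
      ultimately have "R (s i) (s k)" by (intro class_s) simp
      moreover have "i = k \<or> R (s k) (s i)" using desc k by (cases "i = k") auto
      ultimately show False using comparison_irrefl[OF R] comparison_trans[OF R] by metis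
    qed
  qed
  have dist: "v (s i - s j) = \<rho>" if "i \<noteq> j" for i j
    using that dist_less[of i j] dist_less[of j i] v_diff_commute[of "s i" "s j"]
    by (cases i j rule: linorder_cases) auto
  have inj: "inj s"
  proof (rule injI)
    fix i j assume "s i = s j"
    then show "i = j" using dist[of i j] x0(2) by (cases "i = j") (auto simp: v_0)
  qed
  obtain N where N: "\<And>c T. finite T \<Longrightarrow> equidistant T \<Longrightarrow>
      card {t \<in> T. R t c} < N \<or> card {t \<in> T. \<not> R t c} < N"
    using comparison_equidistant[OF R] by blast
  \<comment> \<open>Of these \<open>2 * N + 1\<close> points, \<open>N\<close> lie beyond
    \<open>s N\<close> in the descent and \<open>N + 1\<close> do not, so neither part has fewer
    than \<open>N\<close> elements.\<close>
  let ?T = "s ` {..2 * N}"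
  have "equidistant ?T" unfolding equidistant_def by (rule exI[of _ \<rho>]) (auto intro: dist)
  moreover have "s ` {N<..2 * N} \<subseteq> {t \<in> ?T. R t (s N)}" using desc by auto
  moreover have "s ` {..N} \<subseteq> {t \<in> ?T. \<not> R t (s N)}"
  proof -
    have "\<not> R (s i) (s N)" if "i \<le> N" for i
      using desc[of i N] that comparison_irrefl[OF R] comparison_trans[OF R]
      by (metis le_neq_implies_less)
    then show ?thesis by auto
  qed
  moreover have "card (s ` {N<..2 * N}) = N" "card (s ` {..N}) = Suc N"
    using inj by (simp_all add: card_image inj_on_subset[OF inj])
  ultimately show False
    using N[of ?T "s N"] card_mono[of "{t \<in> ?T. R t (s N)}" "s ` {N<..2 * N}"]
      card_mono[of "{t \<in> ?T. \<not> R t (s N)}" "s ` {..N}"] by simp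
qed

text \<open>Of the two alternatives near infinity, universal domination already fails at a single
  valuation below \<open>v e\<close>.\<close>

lemma not_dominating_near_infinity:
  assumes "comparison R"
  shows "\<exists>e. e \<noteq> 0 \<and> (\<forall>x. v x < v e \<longrightarrow> \<not> dominating R x)"
proof -
  obtain e where e: "e \<noteq> 0"
    "(\<forall>x. v x < v e \<longrightarrow> dominating R x) \<or> (\<forall>x. v x < v e \<longrightarrow> \<not> dominating R x)"
    using dominating_const_near_infinity[OF assms] unfolding const_near_infinity_def by blast
  moreover have "\<not> (\<forall>x. v x < v e \<longrightarrow> dominating R x)"
  proof
    assume dom: "\<forall>x. v x < v e \<longrightarrow> dominating R x"
    obtain x where "v x < v e" using unbounded[OF e(1)] by blast
    moreover have "v e \<le> Pinf" by simp
    ultimately show False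
      using not_all_dominating[OF assms, of x "v x"] dom by (metis order_less_le_trans)
  qed
  ultimately show ?thesis by blast
qed

text \<open>
  If \<open>v (f x) < v (f x')\<close>, where \<open>x\<close> and \<open>x'\<close> are not dominating and \<open>v x = v x'\<close>, then every
  residue class contains points with values at most \<open>v (f x)\<close> and at least \<open>v (f x')\<close>.
\<close>

lemma incomparable:
  assumes X: "\<And>z. v z = v x \<Longrightarrow> z \<in> X" and v_x: "v x' = v x" "v x < Pinf"
    and x: "\<not> dominating (\<lambda>x y. less_f y x) x" and x': "\<not> dominating less_f x'"
  shows "\<not> less_f x x'"
proof
  assume less: "less_f x x'"
  have comp: "comparison less_f" by (simp add: comparison_def)
  obtain N where N: "\<And>c T. finite T \<Longrightarrow> equidistant T \<Longrightarrow>
      card {t \<in> T. less_f t c} < N \<or> card {t \<in> T. \<not> less_f t c} < N"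
    using comparison_equidistant[OF comp] by blast
  obtain A where A: "finite A" "card A = 2 * N" "\<forall>a\<in>A. v a = 0"
    "\<forall>a\<in>A. \<forall>b\<in>A. a \<noteq> b \<longrightarrow> v (a - b) = 0"
    using residues_exist[of "2 * N"] by (elim exE conjE) (rule that)
  \<comment> \<open>Half of the residue classes are to supply points below \<open>x'\<close>, the
    other half points that are not.\<close>
  obtain B where B: "B \<subseteq> A" "card B = N" "finite B"
    using obtain_subset_with_card_n[of N A] A(2) by auto
  have point: "\<exists>z. v x < v (z - y) \<and> (less_f z x' \<longleftrightarrow> p)" if y: "v y = v x" for y p
  proof (cases p)
    case False
    have "\<exists>z. v x < v (z - y) \<and> \<not> less_f z x'"
      using x' y unfolding dominating_def v_x by blast
    with False show ?thesis by blast
  next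
    case True
    obtain z where z: "v x < v (z - y)" "\<not> less_f x z"
      using x y unfolding dominating_def by blast
    \<comment> \<open>Having the valuation of \<open>x\<close>, the point \<open>z\<close> lies in
      \<open>X\<close>; hence \<open>\<not> less_f x z\<close> yields
      \<open>v (f z) \<le> v (f x)\<close>, which is less than \<open>v (f x')\<close>.\<close>
    have "v z = v x" using v_diff_perturb[of y 0 z] z(1) y by simp
    then have "less_f z x'" using less z(2) X by (auto simp: less_f_def)
    with True z(1) show ?thesis by blast
  qed
  \<comment> \<open>Scaling the residues by \<open>x\<close> gives one center \<open>x * a\<close>
    of valuation \<open>v x\<close> for each class.\<close>
  have "\<forall>a. \<exists>z. a \<in> A \<longrightarrow> v x < v (z - x * a) \<and> (less_f z x' \<longleftrightarrow> a \<in> B)"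
    using point A(3) by (simp add: v_mult)
  from choice[OF this] obtain g
    where g: "\<And>a. a \<in> A \<Longrightarrow> v x < v (g a - x * a)" "\<And>a. a \<in> A \<Longrightarrow> less_f (g a) x' \<longleftrightarrow> a \<in> B"
    by auto
  \<comment> \<open>The distance between the centers survives replacing first one and then the other
    by the chosen point of its class.\<close>
  have dist: "v (g a - g b) = v x" if ab: "a \<in> A" "b \<in> A" "a \<noteq> b" for a b
  proof -
    have xab: "v (x * a - x * b) = v x"
      using A(4) ab by (simp add: v_mult flip: right_diff_distrib)
    then have "v (g a - x * b) = v x"
      using v_diff_perturb[of "x * a" "x * b" "g a"] g(1)[OF ab(1)] by simp
    then have "v (x * b - g a) = v x" by (simp add: v_diff_commute)
    then have "v (g b - g a) = v x"
      using v_diff_perturb[of "x * b" "g a" "g b"] g(1)[OF ab(2)] by simp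
    then show ?thesis by (simp add: v_diff_commute)
  qed
  have inj: "inj_on g A"
    using dist v_x(2) by (intro inj_onI) (metis diff_self less_irrefl v_0)
  have "equidistant (g ` A)" unfolding equidistant_def using dist by blast
  moreover have "{t \<in> g ` A. less_f t x'} = g ` B" using g(2) B(1) by auto
  moreover have "{t \<in> g ` A. \<not> less_f t x'} = g ` (A - B)" using g(2) B(1) by auto
  moreover have "card (g ` B) = N" "card (g ` (A - B)) = N"
    using A B inj by (simp_all add: card_image inj_on_subset[OF inj] card_Diff_subset)
  ultimately show False using N[of "g ` A" x'] A(1) by simp
qed

text \<open>Near infinity no point dominates in either direction, so \<open>incomparable\<close>
  rules out a strict inequality both ways.\<close>

lemma v_f_factors_near_infinity:
  assumes near: "d \<noteq> 0" "\<And>x. v x < v d \<Longrightarrow> x \<in> X"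
  shows "\<exists>e. e \<noteq> 0 \<and> (\<forall>x x'. v x < v e \<longrightarrow> v x' = v x \<longrightarrow> x \<in> X \<and> v (f x') = v (f x))"
proof -
  have "comparison less_f" "comparison (\<lambda>x y. less_f y x)"
    by (simp_all add: comparison_def)
  then obtain e1 e2
    where e1: "e1 \<noteq> 0" "\<And>x. v x < v e1 \<Longrightarrow> \<not> dominating less_f x"
      and e2: "e2 \<noteq> 0" "\<And>x. v x < v e2 \<Longrightarrow> \<not> dominating (\<lambda>x y. less_f y x) x"
    using not_dominating_near_infinity by meson
  obtain e3 where e3: "e3 \<noteq> 0" "v e3 \<le> v e1" "v e3 \<le> v e2"
    using common_radius[OF e1(1) e2(1)] by blast
  obtain e where e: "e \<noteq> 0" "v e \<le> v e3" "v e \<le> v d"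
    using common_radius[OF e3(1) near(1)] by blast
  have not_less_f: "\<not> less_f x x'" if v_x: "v x < v e" "v x' = v x" for x x'
  proof (rule incomparable)
    show "z \<in> X" if "v z = v x" for z using near(2)[of z] e(3) v_x that by simp
    show "\<not> dominating (\<lambda>x y. less_f y x) x" using e2(2)[of x] e e3 v_x by simp
    show "\<not> dominating less_f x'" using e1(2)[of x'] e e3 v_x by simp
    show "v x < Pinf" using v_x(1) by (metis le_Pinf order_less_le_trans)
    show "v x' = v x" by fact
  qed
  have "x \<in> X \<and> v (f x') = v (f x)" if v_x: "v x < v e" "v x' = v x" for x x'
  proof -
    have "x \<in> X" "x' \<in> X" using near(2) e(3) v_x by simp_all
    moreover have "\<not> less_f x x'" by (rule not_less_f) fact+
    moreover have "\<not> less_f x' x" by (rule not_less_f) (simp_all add: v_x)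
    ultimately show ?thesis by (simp add: less_f_def not_less)
  qed
  then show ?thesis using e(1) by blast
qed

section \<open>The induced function on the value group\<close>

lemma definable_value_fun_exists:
  assumes e: "e \<noteq> 0" and f: "\<And>x. x \<in> X \<Longrightarrow> f x \<noteq> 0"
    and fac: "\<And>x x'. v x < v e \<Longrightarrow> v x' = v x \<Longrightarrow> x \<in> X \<and> v (f x') = v (f x)"
  shows "\<exists>h. definable_value_fun L M v h \<and> (\<forall>x. v x < v e \<longrightarrow> v (f x) = map_extended h (v x))"
proof -
  \<comment> \<open>By \<open>fac\<close> the described value is unique below \<open>v e\<close>;
    elsewhere the default 0 keeps \<open>h\<close> total with values in the value group, as
    \<open>v 1 = 0\<close>.\<close>
  define h where "h \<gamma> = (if Fin \<gamma> < v e then THE \<delta>. \<forall>x. v x = Fin \<gamma> \<longrightarrow> v (f x) = Fin \<delta> else 0)" for \<gamma>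
  have h: "v (f x) = Fin (h \<gamma>)" if x: "v x = Fin \<gamma>" "v x < v e" for x \<gamma>
  proof -
    have "x \<in> X" using fac[of x x] x by simp
    with f obtain \<delta> where \<delta>: "v (f x) = Fin \<delta>" using v_Fin by blast
    have "h \<gamma> = (THE \<delta>. \<forall>x. v x = Fin \<gamma> \<longrightarrow> v (f x) = Fin \<delta>)"
      using x by (simp add: h_def)
    also have "\<dots> = \<delta>"
    proof (rule the_equality)
      show "\<forall>x'. v x' = Fin \<gamma> \<longrightarrow> v (f x') = Fin \<delta>"
        using fac[OF x(2)] \<delta> x(1) by simp
    qed (use x \<delta> in auto)
    finally show ?thesis using \<delta> by simp
  qed
  have h_far: "h \<gamma> = 0" if "\<not> Fin \<gamma> < v e" for \<gamma>
    using that by (simp add: h_def)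
  have h_vg: "h ` value_group v \<subseteq> value_group v"
  proof
    fix \<delta> assume "\<delta> \<in> h ` value_group v"
    then obtain x \<gamma> where "v x = Fin \<gamma>" "\<delta> = h \<gamma>" by (auto simp: value_group_def)
    then have "v (f x) = Fin \<delta> \<or> v 1 = Fin \<delta>"
      using h h_far by (auto simp: v_1 zero_extended_def)
    then show "\<delta> \<in> value_group v" by (auto simp: value_group_def)
  qed
  \<comment> \<open>Variables 2, 3 and 4 will hold \<open>e\<close>, 0 and 1: the threshold, the
    excluded argument of infinite valuation, and an element with the default value.\<close>
  let ?P = "\<lambda>\<sigma>. \<not> \<sigma> 0 = \<sigma> 3 \<and>
      (\<not> v (\<sigma> 2) \<le> v (\<sigma> 0) \<longrightarrow> (\<exists>w. (\<sigma> 0 \<in> X \<and> w = f (\<sigma> 0)) \<and> v w \<le> v (\<sigma> 1) \<and> v (\<sigma> 1) \<le> v w)) \<and>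
      (v (\<sigma> 2) \<le> v (\<sigma> 0) \<longrightarrow> v (\<sigma> 1) \<le> v (\<sigma> 4) \<and> v (\<sigma> 4) \<le> v (\<sigma> 1))"
  have "expressible (\<lambda>\<sigma>. (\<sigma> 0 \<in> X \<and> \<sigma> 5 = f (\<sigma> 0)) \<and> v (\<sigma> 5) \<le> v (\<sigma> 1) \<and> v (\<sigma> 1) \<le> v (\<sigma> 5))"
    by (intro expressible_conj expressible_graph expressible_v_le) auto
  from expressible_ex[OF this, of 5]
  have ex: "expressible (\<lambda>\<sigma>. \<exists>w. (\<sigma> 0 \<in> X \<and> w = f (\<sigma> 0)) \<and> v w \<le> v (\<sigma> 1) \<and> v (\<sigma> 1) \<le> v w)"
    by simp
  have P: "expressible ?P"
    by (intro expressible_conj expressible_imp expressible_not expressible_eq expressible_v_le ex)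
  let ?\<sigma> = "(\<lambda>i. \<tau> (i - 10))(2 := e, 3 := 0, 4 := 1)"
  have "admissible ?\<sigma>" by (intro admissible_upd admissible_\<tau>) auto
  from expressible_definable[OF P this]
  have def: "definable L M 2 {[x, y] | x y. x \<noteq> 0 \<and> (v x < v e \<longrightarrow> x \<in> X \<and> v y = v (f x)) \<and>
      (\<not> v x < v e \<longrightarrow> v y = 0)}"
    by (simp add: v_1 conj_ac not_le[symmetric] flip: order_eq_iff)
  \<comment> \<open>This matches the set defined in the field with the preimage under
    \<open>v\<close> of the graph of \<open>h\<close>, as \<open>interpretable\<close>
    requires.\<close>
  have iff: "(\<exists>\<gamma>. \<gamma> \<in> value_group v \<and> v x = Fin \<gamma> \<and> v y = Fin (h \<gamma>)) \<longleftrightarrow>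
      x \<noteq> 0 \<and> (v x < v e \<longrightarrow> x \<in> X \<and> v y = v (f x)) \<and> (\<not> v x < v e \<longrightarrow> v y = 0)" for x y
  proof (cases "x = 0")
    case True
    then show ?thesis by (simp add: v_0)
  next
    case False
    then obtain \<gamma> where \<gamma>: "v x = Fin \<gamma>" using v_Fin by blast
    then have "\<gamma> \<in> value_group v" by (auto simp: value_group_def)
    then show ?thesis
      using False \<gamma> h[OF \<gamma>] h_far[of \<gamma>] fac[of x x] by (auto simp: zero_extended_def)
  qed
  have "{xs. \<exists>\<gamma>s\<in>{[\<gamma>, h \<gamma>] | \<gamma>. \<gamma> \<in> value_group v}. map v xs = map Fin \<gamma>s} =
      {[x, y] | x y. \<exists>\<gamma>. \<gamma> \<in> value_group v \<and> v x = Fin \<gamma> \<and> v y = Fin (h \<gamma>)}"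
    by (auto simp: map_eq_Cons_conv Cons_eq_map_conv)
  with def have "interpretable L M v 2 {[\<gamma>, h \<gamma>] | \<gamma>. \<gamma> \<in> value_group v}"
    using h_vg by (auto simp: interpretable_def iff)
  then have "definable_value_fun L M v h"
    using h_vg by (simp add: definable_value_fun_def)
  moreover have "v (f x) = map_extended h (v x)" if "v x < v e" for x
  proof -
    have "x \<noteq> 0" using that by (auto simp: v_0)
    then obtain \<gamma> where "v x = Fin \<gamma>" using v_Fin by blast
    then show ?thesis using h[of x \<gamma>] that by simp
  qed
  ultimately show ?thesis by blast
qed

end

theorem theorem3p1:
  fixes L :: "('f vf_fsym, 'r vf_rsym) language"
    and M :: "('f vf_fsym, 'r vf_rsym, 'a::alg_closed_field) fo_structure"
    and v :: "'a \<Rightarrow> 'g::linordered_ab_group_add extended"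
    and X :: "'a set" and f :: "'a \<Rightarrow> 'a"
  assumes "C_minimal_valued_field L M v"
    and "definable_fun L M X f"
    and "\<And>x. x \<in> X \<Longrightarrow> f x \<noteq> 0"
    and "defined_near_infinity v X"
  shows "\<exists>h \<gamma>\<^sub>0. definable_value_fun L M v h \<and> \<gamma>\<^sub>0 \<in> value_group v \<and>
           (\<forall>x \<in> X - closed_ball v 0 (Fin \<gamma>\<^sub>0). v (f x) = map_extended h (v x))"
proof -
  have val: "valuation v" and univ_M: "univ M = UNIV"
    using assms(1) by (auto simp: C_minimal_valued_field_def nontrivial_valuation_def
        expands_valued_field_def)
  obtain \<phi> \<tau> where wf: "wf_fm L \<phi>" and graph: "{[x, f x] | x. x \<in> X} =
      {xs. length xs = 2 \<and> set xs \<subseteq> univ M \<and> sat M (\<lambda>i. if i < 2 then xs ! i else \<tau> i) \<phi>}"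
    using assms(2) by (auto simp: definable_fun_def definable_def)
  have "sat M (\<lambda>i. if i = 0 then x else if i = 1 then y else \<tau> i) \<phi> \<longleftrightarrow> x \<in> X \<and> y = f x" for x y
  proof -
    have "(\<lambda>i. if i = 0 then x else if i = 1 then y else \<tau> i) =
        (\<lambda>i. if i < 2 then [x, y] ! i else \<tau> i)"
      by (auto simp: fun_eq_iff less_2_cases_iff)
    moreover have "sat M (\<lambda>i. if i < 2 then [x, y] ! i else \<tau> i) \<phi> \<longleftrightarrow> [x, y] \<in> {[x, f x] | x. x \<in> X}"
      unfolding graph by (simp add: univ_M)
    ultimately show ?thesis by auto
  qed
  then interpret definable_function L M v X f \<phi> \<tau>
    by unfold_locales (use val assms(1) wf in auto)
  obtain \<gamma> where "\<gamma> \<in> value_group v" and \<gamma>: "UNIV - closed_ball v 0 (Fin \<gamma>) \<subseteq> X"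
    using assms(4) by (auto simp: defined_near_infinity_def)
  then obtain d where d: "v d = Fin \<gamma>" by (auto simp: value_group_def)
  have "d \<noteq> 0" using d by (auto simp: v_0)
  moreover have "x \<in> X" if "v x < v d" for x
    using \<gamma> d that by (auto simp: closed_ball_def)
  ultimately obtain e where e: "e \<noteq> 0"
    "\<And>x x'. v x < v e \<Longrightarrow> v x' = v x \<Longrightarrow> x \<in> X \<and> v (f x') = v (f x)"
    using v_f_factors_near_infinity[of d] by blast
  obtain h where h: "definable_value_fun L M v h"
    "\<And>x. v x < v e \<Longrightarrow> v (f x) = map_extended h (v x)"
    using definable_value_fun_exists[OF e(1) assms(3) e(2)] by blast
  obtain \<gamma>\<^sub>0 where \<gamma>\<^sub>0: "v e = Fin \<gamma>\<^sub>0" using v_Fin[OF e(1)] by blast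
  then have "\<gamma>\<^sub>0 \<in> value_group v" by (auto simp: value_group_def)
  moreover have "v (f x) = map_extended h (v x)" if "x \<in> X - closed_ball v 0 (Fin \<gamma>\<^sub>0)" for x
    using that h(2)[of x] \<gamma>\<^sub>0 by (auto simp: closed_ball_def not_le)
  ultimately show ?thesis using h(1) by blast
qed

end
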